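(* Let $\mathcal M$ be a convex set of compactly supported distributions on $\mathbb R$ for which there exist three distinct points $x,y,z\in\mathbb R$ with $\delta_x,\delta_y,\delta_z\in\mathcal M$. Let $h\in\mathcal H^{\rm DT}$. The following statements are equivalent. (i) $h$ is convex on $[0,1]$, or $I_h$ is a min-quantile mixture. (ii) $I_h$ is p-quasi-convex on $\mathcal M$. (iii) $R_{h,v}$ is p-quasi-convex on $\mathcal M$ for some increasing $v\in\mathcal V_{\mathcal M}$. (iv) $R_{h,v}$ is p-quasi-convex on $\mathcal M$ for all increasing functions $v:\mathbb R\to\mathbb R$.
   Context: A distribution is a Borel probability measure on $\mathbb R$; for a distribution $F$ write $F(x)=F((-\infty,x])$. $\delta_x$ is the point mass at $x$. $\mathcal M_c$ is the set of compactly supported distributions. "Increasing" is meant in the non-strict sense. $\mathcal H^{\rm DT}$ is the set of increasing $h:[0,1]\to\mathbb R$ with $h(0)=0$ and $h(1)=1$. For $h\in\mathcal H^{\rm DT}$, $I_h(F)=\int_0^\infty h(F((x,\infty)))\,dx+\int_{-\infty}^0\big(h(F((x,\infty)))-h(1)\big)\,dx$. For $v:\mathbb R\to\mathbb R$, $R_{h,v}(F)=I_h(F\circ v^{-1})$, where $F\circ v^{-1}$ is the push-forward of $F$ under $v$. $\mathcal V_{\mathcal M}$ is the set of measurable functions $v:\mathbb R\to\mathbb R$ such that $v(x),v(y),v(z)$ are distinct for some $x,y,z$ with $\delta_x,\delta_y,\delta_z\in\mathcal M$. A functional $\rho$ on a convex set $\mathcal M$ of distributions is p-quasi-convex if $\rho(\lambda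 F+(1-\lambda)G)\le\max\{\rho(F),\rho(G)\}$ for all $F,G\in\mathcal M$, $\lambda\in[0,1]$. Quantiles: for $\alpha\in(0,1)$, $Q_\alpha^-(F)=\inf\{x:F(x)\ge\alpha\}$, $Q_\alpha^+(F)=\inf\{x:F(x)>\alpha\}$; $Q_0^\pm(F)=Q_0(F)=\inf\{x:F(x)>0\}$; $Q_1^\pm(F)=Q_1(F)=\inf\{x:F(x)\ge1\}$. For $c,\alpha\in[0,1]$, $Q_\alpha^c=cQ_\alpha^++(1-c)Q_\alpha^-$. $I_h$ is a min-quantile mixture if there are $\alpha,c,k\in[0,1]$ with $I_h(F)=kQ_\alpha^c(F)+(1-k)Q_0(F)$ for all $F\in\mathcal M_c$. *)

theory Defs
  imports "HOL-Probability.Probability"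
begin

definition compactly_supported :: "real measure set" where
  "compactly_supported =
     {F. real_distribution F \<and> (\<exists>K. compact K \<and> measure F K = 1)}"

definition mixture :: "real \<Rightarrow> real measure \<Rightarrow> real measure \<Rightarrow> real measure" where
  "mixture l F G = measure_of UNIV (sets borel)
     (\<lambda>A. ennreal l * emeasure F A + ennreal (1 - l) * emeasure G A)"

text \<open>\<^const>\<open>measure_of\<close> is only meaningful if its argument is countably additive; the following
  two lemmas check that this is so here.\<close>

lemma emeasure_mixture:
  assumes "sets F = sets borel" "sets G = sets borel" "A \<in> sets borel"
  shows "emeasure (mixture l F G) A =
    ennreal l * emeasure F A + ennreal (1 - l) * emeasure G A"
proof (rule emeasure_measure_of[OF mixture_def])
  let ?m = "\<lambda>A. ennreal l * emeasure F A + ennreal (1 - l) * emeasure G A"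
  have s: "sets (mixture l F G) = sets borel"
    unfolding mixture_def using sets.sigma_sets_eq[of "borel :: real measure"]
    by (simp add: sets_measure_of)
  show "sets (borel :: real measure) \<subseteq> Pow UNIV" by simp
  show "A \<in> sets (mixture l F G)" using s assms(3) by simp
  show "positive (sets (mixture l F G)) ?m" by (simp add: positive_def)
  show "countably_additive (sets (mixture l F G)) ?m"
  proof (rule countably_additiveI)
    fix B :: "nat \<Rightarrow> real set"
    assume B: "range B \<subseteq> sets (mixture l F G)" "disjoint_family B"
    then have "(\<Sum>i. emeasure F (B i)) = emeasure F (\<Union>i. B i)"
      and "(\<Sum>i. emeasure G (B i)) = emeasure G (\<Union>i. B i)"
      using s assms by (auto intro!: suminf_emeasure)
    moreover have "(\<Sum>i. ?m (B i)) =
        (\<Sum>i. ennreal l * emeasure F (B i)) + (\<Sum>i. ennreal (1 - l) * emeasure G (B i))"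
      by (rule suminf_add[symmetric]) (auto simp: summableI)
    ultimately show "(\<Sum>i. ?m (B i)) = ?m (\<Union>i. B i)"
      by simp
  qed
qed

lemma real_distribution_mixture:
  assumes "real_distribution F" "real_distribution G" "l \<in> {0..1}"
  shows "real_distribution (mixture l F G)"
proof -
  interpret F: real_distribution F by fact
  interpret G: real_distribution G by fact
  have s: "sets (mixture l F G) = sets borel"
    unfolding mixture_def using sets.sigma_sets_eq[of "borel :: real measure"]
    by (simp add: sets_measure_of)
  then have sp: "space (mixture l F G) = UNIV"
    using sets_eq_imp_space_eq by fastforce
  have "emeasure (mixture l F G) UNIV = 1"
    using assms(3) F.emeasure_space_1 G.emeasure_space_1
    by (simp add: emeasure_mixture flip: ennreal_plus)
  then show ?thesis
    using s sp by (auto simp: real_distribution_def real_distribution_axioms_def intro!: prob_spaceI)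
qed

definition convex_distributions :: "real measure set \<Rightarrow> bool" where
  "convex_distributions M \<longleftrightarrow>
     (\<forall>F\<in>M. \<forall>G\<in>M. \<forall>l\<in>{0..1}. mixture l F G \<in> M)"

definition p_quasi_convex_on ::
  "real measure set \<Rightarrow> (real measure \<Rightarrow> real) \<Rightarrow> bool" where
  "p_quasi_convex_on M \<rho> \<longleftrightarrow>
     (\<forall>F\<in>M. \<forall>G\<in>M. \<forall>l\<in>{0..1}. \<rho> (mixture l F G) \<le> max (\<rho> F) (\<rho> G))"

text \<open>Functions on the unit interval are represented by total functions on the reals, whose values
  off the interval play no role.\<close>

definition H_DT :: "(real \<Rightarrow> real) set" where
  "H_DT = {h. mono_on {0..1} h \<and> h 0 = 0 \<and> h 1 = 1}"

definition I_fun :: "(real \<Rightarrow> real) \<Rightarrow> real measure \<Rightarrow> real" where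
  "I_fun h F = (LBINT x:{0..}. h (measure F {x<..})) +
               (LBINT x:{..0}. h (measure F {x<..}) - h 1)"

definition R_fun :: "(real \<Rightarrow> real) \<Rightarrow> (real \<Rightarrow> real) \<Rightarrow> real measure \<Rightarrow> real" where
  "R_fun h v F = I_fun h (distr F borel v)"

definition V_set :: "real measure set \<Rightarrow> (real \<Rightarrow> real) set" where
  "V_set M = {v \<in> borel_measurable borel. \<exists>x y z.
     return borel x \<in> M \<and> return borel y \<in> M \<and> return borel z \<in> M \<and>
     v x \<noteq> v y \<and> v x \<noteq> v z \<and> v y \<noteq> v z}"

definition Q0 :: "real measure \<Rightarrow> real" where
  "Q0 F = Inf {x. cdf F x > 0}"

definition Q1 :: "real measure \<Rightarrow> real" where
  "Q1 F = Inf {x. cdf F x \<ge> 1}"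

definition Q_minus :: "real \<Rightarrow> real measure \<Rightarrow> real" where
  "Q_minus \<alpha> F =
     (if \<alpha> = 0 then Q0 F else if \<alpha> = 1 then Q1 F else Inf {x. cdf F x \<ge> \<alpha>})"

definition Q_plus :: "real \<Rightarrow> real measure \<Rightarrow> real" where
  "Q_plus \<alpha> F =
     (if \<alpha> = 0 then Q0 F else if \<alpha> = 1 then Q1 F else Inf {x. cdf F x > \<alpha>})"

definition Q_mix :: "real \<Rightarrow> real \<Rightarrow> real measure \<Rightarrow> real" where
  "Q_mix c \<alpha> F = c * Q_plus \<alpha> F + (1 - c) * Q_minus \<alpha> F"

definition min_quantile_mixture :: "(real measure \<Rightarrow> real) \<Rightarrow> bool" where
  "min_quantile_mixture \<rho> \<longleftrightarrow>
     (\<exists>\<alpha>\<in>{0..1}. \<exists>c\<in>{0..1}. \<exists>k\<in>{0..1}. \<forall>F\<in>compactly_supported.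
        \<rho> F = k * Q_mix c \<alpha> F + (1 - k) * Q0 F)"

end

(* On the mixtures of three point masses at a < b < c, the functional is
   a + (b - a) h(s) + (c - b) h(t), where s and t are the probabilities of {b, c} and {c}. Hence
   (s, t) |-> u h(s) + w h(t) is quasi-convex on 0 <= t <= s <= 1 for some u, w > 0. Two jumps of h
   in [0,1), or a jump and an increase elsewhere in (0,1), give a segment that violates this. So
   either h is a step function, which makes I_h a min-quantile mixture, or h is continuous on
   [0,1). In the latter case, if h lay above one of its chords, then for two slopes
   sigma1 > sigma2 > 0 the smallest maximizers m1 <= m2 of h(x) - sigma_i x would be interior
   points. For m1 < m2 the segment through (m2, m1) in the direction tangent to the level sets
   violates quasi-convexity; for m1 = m2 the function h has a concave kink, which is excluded by
   pairing it with another point.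

   Conversely, convexity of h makes I_h convex, and for a min-quantile mixture each of Q_alpha^-,
   Q_alpha^+ and Q_0 of a proper mixture is bounded by its value at the component with the larger
   Q_alpha^-. Both properties concern all compactly supported distributions, and increasing
   functions v map these to compactly supported distributions. *)

theory Submission
  imports Defs
begin

section \<open>Quasi-convexity of separable sums of one distortion function\<close>

text \<open>A monotone function need not be differentiable at a given point, but maximizing its difference
  to an exponential that is steep enough yields an interior point where the exponential supports
  it from above.\<close>

lemma continuous_slope_exists:
  fixes f :: "real \<Rightarrow> real"
  assumes "a < b" "continuous_on {a..b} f" "mono_on {a..b} f" "f a < f b"
    and p: "a < p" "p < b" "f a < f p"
  obtains t \<tau> where "a < t" "t < b" "0 < \<tau>"
    "\<And>e. 0 < e \<Longrightarrow> \<forall>\<^sub>F y in at_right 0. f (t + y) - f t \<le> \<tau> * (1 + e) * y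
       \<and> \<tau> * (1 - e) * y \<le> f t - f (t - y)"
proof -
  \<comment> \<open>\<open>c\<close> is the fraction of the increase of \<open>f\<close> that is
    reached at \<open>p\<close>; \<open>M\<close> is so large that the exponential, equal to 1 at
    \<open>b\<close>, is below \<open>c\<close> at \<open>p\<close>.\<close>
  define c where "c = (f p - f a) / (f b - f a)"
  have c: "0 < c" using assms by (simp add: c_def)
  obtain n where n: "- ln c < real n * (b - p)" using reals_Archimedean3[of "b - p"] p by auto
  define M where "M = real n + 1"
  have "- ln c < M * (b - p)" using n p by (simp add: M_def algebra_simps)
  then have "- M * (b - p) < ln c" by simp
  then have M: "exp (- M * (b - p)) < c" "0 < M"
    using c exp_less_mono[of "- M * (b - p)" "ln c"] by (auto simp: M_def)
  define g where "g x = exp (M * (x - b))" for x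
  have gab: "g a < g b" using assms(1) M(2) by (auto simp: g_def mult_less_0_iff)
  \<comment> \<open>This scaling makes \<open>F a = F b\<close>. As \<open>F p\<close> is larger,
    the maximum of \<open>F\<close> is interior.\<close>
  define A where "A = (f b - f a) / (g b - g a)"
  have A: "0 < A" using assms gab by (simp add: A_def)
  define F where "F x = f x - A * g x" for x
  have Fab: "F b = F a"
  proof -
    have "A * (g b - g a) = f b - f a" using gab by (simp add: A_def)
    then show ?thesis by (simp add: F_def algebra_simps)
  qed
  have "F a < F p"
  proof -
    have "g p - g a < c * (g b - g a)"
    proof -
      have "f p \<le> f b" using assms by (auto simp: mono_on_def)
      then have "c \<le> 1" using assms by (simp add: c_def)
      then have "0 \<le> (1 - c) * g a" by (simp add: g_def)
      moreover have "g p < c" "g b = 1" using M by (auto simp: g_def algebra_simps)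
      ultimately show ?thesis by (simp add: algebra_simps)
    qed
    then have "A * (g p - g a) < A * (c * (g b - g a))" using A by simp
    also have "\<dots> = f p - f a" using assms gab by (simp add: A_def c_def)
    finally show ?thesis by (simp add: F_def algebra_simps)
  qed
  have "continuous_on {a..b} F"
    unfolding F_def g_def by (intro continuous_intros assms)
  then obtain t where t: "t \<in> {a..b}" "\<And>x. x \<in> {a..b} \<Longrightarrow> F x \<le> F t"
    using continuous_attains_sup[of "{a..b}" F] assms by auto
  have "F p \<le> F t" using t p by auto
  then have "t \<noteq> a" "t \<noteq> b" using \<open>F a < F p\<close> Fab by auto
  then have tab: "a < t" "t < b" using t by auto
  define \<tau> where "\<tau> = A * (M * g t)"
  have tau: "0 < \<tau>" using A M by (simp add: \<tau>_def g_def)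
  have gd: "(g has_real_derivative M * g t) (at t)"
    unfolding g_def by (auto intro!: derivative_eq_intros)
  show thesis
  proof (rule that[OF tab tau])
    fix e :: real assume e: "0 < e"
    have Mg: "0 < M * g t" using M by (simp add: g_def)
    then have "0 < e * (M * g t)" using e by simp
    then have lo: "(1 - e) * (M * g t) < M * g t" and up: "M * g t < (1 + e) * (M * g t)"
      by (simp_all add: algebra_simps)
    have lim: "((\<lambda>y. (g (t + y) - g t) / y) \<longlongrightarrow> M * g t) (at 0)"
      using gd by (simp add: DERIV_def)
    then have "((\<lambda>y. (g (t + y) - g t) / y) \<longlongrightarrow> M * g t) (at_right 0)"
      by (rule filterlim_mono) (auto simp: at_le)
    then have ev1: "\<forall>\<^sub>F y in at_right 0. (g (t + y) - g t) / y < (1 + e) * (M * g t)"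
      using up by (rule order_tendstoD)
    have "((\<lambda>y. (g (t + y) - g t) / y) \<longlongrightarrow> M * g t) (at_left 0)"
      using lim by (rule filterlim_mono) (auto simp: at_le)
    then have "((\<lambda>y. (g (t - y) - g t) / (- y)) \<longlongrightarrow> M * g t) (at_right 0)"
      by (simp add: filterlim_at_left_to_right)
    then have ev2: "\<forall>\<^sub>F y in at_right 0. (1 - e) * (M * g t) < (g (t - y) - g t) / (- y)"
      using lo by (rule order_tendstoD)
    have ev3: "\<forall>\<^sub>F y in at_right 0. y \<in> {0<..<min (t - a) (b - t)}"
      by (rule eventually_at_right_real) (use tab in auto)
    show "\<forall>\<^sub>F y in at_right 0. f (t + y) - f t \<le> \<tau> * (1 + e) * y
       \<and> \<tau> * (1 - e) * y \<le> f t - f (t - y)"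
      using ev1 ev2 ev3
    proof eventually_elim
      case (elim y)
      have "g (t + y) - g t \<le> (1 + e) * (M * g t) * y"
        using elim by (simp add: field_simps)
      then have "A * (g (t + y) - g t) \<le> A * ((1 + e) * (M * g t) * y)"
        using A by (intro mult_left_mono) auto
      moreover have "(1 - e) * (M * g t) * y \<le> g t - g (t - y)"
        using elim by (simp add: field_simps)
      then have "A * ((1 - e) * (M * g t) * y) \<le> A * (g t - g (t - y))"
        using A by (intro mult_left_mono) auto
      \<comment> \<open>Maximality of \<open>F\<close> at \<open>t\<close> turns the increments of
        \<open>A * g\<close> into one-sided bounds for those of \<open>f\<close>.\<close>
      moreover have "F (t + y) \<le> F t" "F (t - y) \<le> F t" using elim by (auto intro!: t(2))
      ultimately show ?case by (simp add: F_def \<tau>_def algebra_simps)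
    qed
  qed
qed

text \<open>The maximizers form a compact set, whose least element gives strictness on the left; the
  value at \<open>z\<close> keeps it off both endpoints.\<close>

lemma smallest_maximizer:
  fixes F :: "real \<Rightarrow> real"
  assumes "continuous_on {a..b} F" "a \<le> z" "z \<le> b" "F a < F z" "F b < F z"
  obtains m where "a < m" "m < b" "\<And>x. a \<le> x \<Longrightarrow> x \<le> b \<Longrightarrow> F x \<le> F m"
    "\<And>x. a \<le> x \<Longrightarrow> x < m \<Longrightarrow> F x < F m"
proof -
  obtain k where k: "k \<in> {a..b}" "\<And>x. x \<in> {a..b} \<Longrightarrow> F x \<le> F k"
    using continuous_attains_sup[of "{a..b}" F] assms by auto
  define S where "S = {a..b} \<inter> F -` {F k}"
  have "closed S" unfolding S_def
    by (rule continuous_closed_preimage[OF assms(1)]) auto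
  then have "compact S" by (simp add: compact_eq_bounded_closed bounded_subset[of "{a..b}"] S_def)
  moreover have "S \<noteq> {}" using k by (auto simp: S_def)
  ultimately obtain m where m: "m \<in> S" "\<And>x. x \<in> S \<Longrightarrow> m \<le> x"
    using compact_attains_inf[of S] by blast
  have Fm: "F m = F k" "a \<le> m" "m \<le> b" using m by (auto simp: S_def)
  have "F z \<le> F m" using k(2)[of z] assms Fm by auto
  then have "m \<noteq> a" "m \<noteq> b" using assms by auto
  moreover have "F x < F m" if "a \<le> x" "x < m" for x
    using k(2)[of x] m(2)[of x] that Fm by (force simp: S_def less_le)
  ultimately show thesis using that[of m] k Fm by auto
qed

section \<open>A quasi-convex sum in two ordered variables\<close>

text \<open>Up to a constant, the sum is the functional at a three-point distribution with gaps
  \<open>u\<close> and \<open>w\<close> between its points; \<open>t \<le> s\<close> orders its two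
  upper tail probabilities.\<close>

locale separable_quasiconvex =
  fixes h :: "real \<Rightarrow> real" and u w :: real
  assumes mono_h: "mono_on {0..1} h"
    and u_pos: "0 < u" and w_pos: "0 < w"
    and quasiconvex: "\<lbrakk>0 \<le> t; t \<le> s; s \<le> 1; 0 \<le> t'; t' \<le> s'; s' \<le> 1; 0 \<le> l; l \<le> 1\<rbrakk> \<Longrightarrow>
      u * h (l * s + (1 - l) * s') + w * h (l * t + (1 - l) * t')
        \<le> max (u * h s + w * h t) (u * h s' + w * h t')"
begin

text \<open>At \<open>\<beta> = 0\<close> there is no left limit, and its role is played by the value \<open>h 0\<close>.\<close>

definition jump :: "real \<Rightarrow> real \<Rightarrow> bool" where
  "jump \<beta> J \<longleftrightarrow> 0 < J \<and>
     (\<forall>x y. 0 \<le> x \<longrightarrow> x < \<beta> \<or> x = 0 \<and> \<beta> = 0 \<longrightarrow> \<beta> < y \<longrightarrow> y \<le> 1 \<longrightarrow> J \<le> h y - h x)"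

lemma h_mono: "0 \<le> x \<Longrightarrow> x \<le> y \<Longrightarrow> y \<le> 1 \<Longrightarrow> h x \<le> h y"
  using mono_h by (auto simp: mono_on_def)

lemma jumpD:
  assumes "jump \<beta> J" "0 \<le> x" "x < \<beta> \<or> x = 0 \<and> \<beta> = 0" "\<beta> < y" "y \<le> 1"
  shows "u * h x + u * J \<le> u * h y" "w * h x + w * J \<le> w * h y"
proof -
  have "J \<le> h y - h x" using assms unfolding jump_def by blast
  then have "h x + J \<le> h y" by simp
  then show "u * h x + u * J \<le> u * h y" "w * h x + w * J \<le> w * h y"
    using u_pos w_pos by (metis distrib_left mult_left_mono less_imp_le)+
qed

text \<open>Only segments with \<open>s\<close> rising and \<open>t\<close> falling carry
  information, since monotonicity already gives the bound when both move the same way.\<close>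

lemma quasiconvex_segment:
  assumes "0 \<le> t1" "t1 < t0" "t0 \<le> s0" "s0 < s1" "s1 \<le> 1" "0 \<le> l" "l \<le> 1"
  shows "u * h ((1 - l) * s0 + l * s1) + w * h ((1 - l) * t0 + l * t1)
    \<le> max (u * h s0 + w * h t0) (u * h s1 + w * h t1)"
  using quasiconvex[of t0 s0 t1 s1 "1 - l"] assms by auto

section \<open>Jumps of \<open>h\<close>\<close>

text \<open>\<open>I\<close> is the right limit of \<open>h\<close> at \<open>\<beta>\<close>, so
  increments just to the right are small even if \<open>h\<close> jumps at \<open>\<beta>\<close>
  itself.\<close>

lemma almost_constant_right:
  assumes "0 \<le> \<beta>" "\<beta> < 1" "0 < e"
  obtains d where "\<beta> < d" "d \<le> 1" "\<And>x y. \<beta> < x \<Longrightarrow> x \<le> y \<Longrightarrow> y \<le> d \<Longrightarrow> h y - h x < e"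
proof -
  define I where "I = Inf (h ` {\<beta><..1})"
  have ne: "h ` {\<beta><..1} \<noteq> {}" using assms by auto
  have bd: "bdd_below (h ` {\<beta><..1})"
    by (rule bdd_belowI[of _ "h 0"]) (use assms h_mono in auto)
  have "I < I + e" using assms by simp
  then obtain d where d: "\<beta> < d" "d \<le> 1" "h d < I + e"
    unfolding I_def cInf_less_iff[OF ne bd] by auto
  have "h y - h x < e" if "\<beta> < x" "x \<le> y" "y \<le> d" for x y
  proof -
    have "I \<le> h x" unfolding I_def by (rule cInf_lower[OF _ bd]) (use that d in auto)
    moreover have "h y \<le> h d" using that d assms by (intro h_mono) auto
    ultimately show ?thesis using d by linarith
  qed
  then show thesis using that d by blast
qed

text \<open>Let \<open>s\<close> cross the jump upwards while \<open>t\<close> falls from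
  \<open>t0\<close> to \<open>t1\<close>. Against the first end the gain \<open>u * J\<close>
  outweighs the loss in \<open>t\<close>; against the second end almost nothing is lost in
  \<open>s\<close>, while an increment \<open>h t - h t1 > 0\<close> is kept. So the point in
  between would lie above both ends.\<close>

lemma jump_constant_left:
  assumes "jump \<beta> J" "\<beta> < 1" "0 \<le> t1" "t1 < t" "t < t0" "t0 < \<beta>"
    and "w * (h t0 - h t1) \<le> u * J"
  shows "h t \<le> h t1"
proof (rule ccontr)
  assume "\<not> h t \<le> h t1"
  then have pos: "0 < w * (h t - h t1)" using w_pos by simp
  obtain s1 where s1: "\<beta> < s1" "s1 \<le> 1"
    "\<And>x y. \<beta> < x \<Longrightarrow> x \<le> y \<Longrightarrow> y \<le> s1 \<Longrightarrow> h y - h x < w * (h t - h t1) / u"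
    using almost_constant_right[of \<beta> "w * (h t - h t1) / u"] assms pos u_pos by auto
  define l where "l = (t0 - t) / (t0 - t1)"
  have l: "0 < l" "l < 1" using assms by (auto simp: l_def divide_simps)
  have lt: "(1 - l) * t0 + l * t1 = t"
  proof -
    have "l * (t0 - t1) = t0 - t" using assms by (simp add: l_def)
    then show ?thesis by (simp add: algebra_simps)
  qed
  \<comment> \<open>\<open>s0\<close> is close enough to \<open>\<beta>\<close> for the point at
    parameter \<open>l\<close> to lie beyond the jump; the lower bound \<open>t0\<close> keeps the
    segment in the domain.\<close>
  define s0 where "s0 = max t0 (\<beta> - l * (s1 - \<beta>) / 2)"
  have lp: "0 < l * (s1 - \<beta>)" using l s1 by simp
  have s0: "t0 \<le> s0" "s0 < \<beta>" "\<beta> - s0 \<le> l * (s1 - \<beta>) / 2"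
    using assms lp unfolding s0_def by linarith+
  define s where "s = (1 - l) * s0 + l * s1"
  have seq: "s - \<beta> = l * (s1 - \<beta>) - (1 - l) * (\<beta> - s0)" by (simp add: s_def algebra_simps)
  have "(1 - l) * (\<beta> - s0) \<le> \<beta> - s0" using l s0 by (simp add: mult_left_le_one_le)
  then have s: "\<beta> < s" using seq s0 lp by linarith
  have ss: "s \<le> s1"
  proof -
    have "s1 - s = (1 - l) * (s1 - s0)" by (simp add: s_def algebra_simps)
    moreover have "0 \<le> (1 - l) * (s1 - s0)" using l s0 s1 by (intro mult_nonneg_nonneg) auto
    ultimately show ?thesis by linarith
  qed
  have "u * h s + w * h t \<le> max (u * h s0 + w * h t0) (u * h s1 + w * h t1)"
    using quasiconvex_segment[of t1 t0 s0 s1 l] assms s0 s1 l unfolding lt s_def by auto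
  moreover have "u * h s0 + u * J \<le> u * h s"
    using jumpD(1)[of \<beta> J s0 s] assms s ss s1 s0 by auto
  moreover have "u * (h s1 - h s) < w * (h t - h t1)"
    using s1(3)[of s s1] s ss u_pos by (simp add: field_simps)
  ultimately show False using pos assms(7) by (simp add: algebra_simps max_def split: if_splits)
qed

text \<open>The mirror image of \<open>jump_constant_left\<close>: now \<open>t\<close> crosses the
  jump downwards while \<open>s\<close> rises from \<open>s0\<close> to \<open>s1\<close>.\<close>

lemma jump_constant_right:
  assumes "jump \<beta> J" "0 \<le> \<beta>" "\<beta> < s0" "s0 < s" "s < s1" "s1 \<le> 1"
    and "u * (h s1 - h s0) \<le> w * J"
  shows "h s \<le> h s0"
proof (rule ccontr)
  assume "\<not> h s \<le> h s0"
  then have pos: "0 < u * (h s - h s0)" using u_pos by simp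
  obtain d where d: "\<beta> < d" "d \<le> 1"
    "\<And>x y. \<beta> < x \<Longrightarrow> x \<le> y \<Longrightarrow> y \<le> d \<Longrightarrow> h y - h x < u * (h s - h s0) / w"
    using almost_constant_right[of \<beta> "u * (h s - h s0) / w"] assms pos w_pos by auto
  define t0 where "t0 = min d s0"
  have t0: "\<beta> < t0" "t0 \<le> s0" "t0 \<le> d" using d assms by (auto simp: t0_def)
  define l where "l = (s - s0) / (s1 - s0)"
  have l: "0 < l" "l < 1" using assms by (auto simp: l_def divide_simps)
  have ls: "(1 - l) * s0 + l * s1 = s"
  proof -
    have "l * (s1 - s0) = s - s0" using assms by (simp add: l_def)
    then show ?thesis by (simp add: algebra_simps)
  qed
  \<comment> \<open>The maximum with 0 covers \<open>\<beta> = 0\<close>: then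
    \<open>t1 = 0\<close>, and the jump is measured from \<open>h 0\<close>.\<close>
  define t1 where "t1 = max 0 (\<beta> - (1 - l) * (t0 - \<beta>) / 2)"
  have lp: "0 < (1 - l) * (t0 - \<beta>)" using l t0 by simp
  have t1: "0 \<le> t1" "t1 < \<beta> \<or> t1 = 0 \<and> \<beta> = 0" "\<beta> - t1 \<le> (1 - l) * (t0 - \<beta>) / 2" "t1 \<le> \<beta>"
    using assms lp unfolding t1_def by linarith+
  define t where "t = (1 - l) * t0 + l * t1"
  have teq: "t - \<beta> = (1 - l) * (t0 - \<beta>) - l * (\<beta> - t1)" by (simp add: t_def algebra_simps)
  have "l * (\<beta> - t1) \<le> \<beta> - t1" using l t1 by (simp add: mult_left_le_one_le)
  then have t: "\<beta> < t" using teq t1 lp by linarith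
  have tt: "t \<le> t0"
  proof -
    have "t0 - t = l * (t0 - t1)" by (simp add: t_def algebra_simps)
    moreover have "0 \<le> l * (t0 - t1)" using l t0 t1 by (intro mult_nonneg_nonneg) auto
    ultimately show ?thesis by linarith
  qed
  have "u * h s + w * h t \<le> max (u * h s0 + w * h t0) (u * h s1 + w * h t1)"
    using quasiconvex_segment[of t1 t0 s0 s1 l] assms t0 t1 l unfolding ls t_def by auto
  moreover have "w * h t1 + w * J \<le> w * h t"
    using jumpD(2)[of \<beta> J t1 t] assms t tt t1 t0 by auto
  moreover have "w * (h t0 - h t) < u * (h s - h s0)"
    using d(3)[of t t0] t tt t0 w_pos by (simp add: field_simps)
  ultimately show False using pos assms(7) by (simp add: algebra_simps max_def split: if_splits)
qed

text \<open>Let \<open>s\<close> rise across the upper jump while \<open>t\<close> falls across the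
  lower one. The midpoint lies to the right of both jumps, so it beats the first end by the jump in
  \<open>s\<close> and the second by the jump in \<open>t\<close>, the other changes being
  small.\<close>

lemma no_two_jumps:
  assumes "jump \<beta>1 J1" "jump \<beta>2 J2" "0 \<le> \<beta>1" "\<beta>1 < \<beta>2" "\<beta>2 < 1"
  shows False
proof -
  have J: "0 < J1" "0 < J2" using assms by (auto simp: jump_def)
  define m where "m = (\<beta>1 + \<beta>2) / 2"
  have m: "\<beta>1 < m" "m < \<beta>2" using assms by (auto simp: m_def)
  obtain s1 where s1: "\<beta>2 < s1" "s1 \<le> 1"
    "\<And>x y. \<beta>2 < x \<Longrightarrow> x \<le> y \<Longrightarrow> y \<le> s1 \<Longrightarrow> h y - h x < w * J1 / u"
    using almost_constant_right[of \<beta>2 "w * J1 / u"] assms J u_pos w_pos by auto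
  obtain d where d: "\<beta>1 < d" "d \<le> 1"
    "\<And>x y. \<beta>1 < x \<Longrightarrow> x \<le> y \<Longrightarrow> y \<le> d \<Longrightarrow> h y - h x < u * J2 / w"
    using almost_constant_right[of \<beta>1 "u * J2 / w"] assms J u_pos w_pos by auto
  define t0 where "t0 = min d m"
  have t0: "\<beta>1 < t0" "t0 \<le> m" "t0 \<le> d" using d m by (auto simp: t0_def)
  \<comment> \<open>\<open>s0\<close> and, below, \<open>t1\<close> are at most half as far from
    their jumps as \<open>s1\<close> and \<open>t0\<close>, which puts the midpoint to the right of
    both jumps.\<close>
  define s0 where "s0 = max m (\<beta>2 - (s1 - \<beta>2) / 2)"
  have s0: "m \<le> s0" "s0 < \<beta>2" "\<beta>2 - s0 \<le> (s1 - \<beta>2) / 2"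
    using m s1(1,2) by (auto simp: s0_def max_def field_simps)
  define t1 where "t1 = max 0 (\<beta>1 - (t0 - \<beta>1) / 2)"
  have t1: "0 \<le> t1" "t1 < \<beta>1 \<or> t1 = 0 \<and> \<beta>1 = 0" "\<beta>1 - t1 \<le> (t0 - \<beta>1) / 2" "t1 \<le> \<beta>1"
    using assms(3) t0 by (auto simp: t1_def max_def field_simps)
  define s where "s = (1 - 1/2) * s0 + 1/2 * s1"
  define t where "t = (1 - 1/2) * t0 + 1/2 * t1"
  have s: "\<beta>2 < s" "s \<le> s1" using s0 s1 unfolding s_def by auto
  have t: "\<beta>1 < t" "t \<le> t0" using t0 t1 unfolding t_def by auto
  have "u * h s + w * h t \<le> max (u * h s0 + w * h t0) (u * h s1 + w * h t1)"
    unfolding s_def t_def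
    by (rule quasiconvex_segment) (use assms t0 t1 s0 s1 in auto)
  moreover have "w * h t1 + w * J1 \<le> w * h t"
    using jumpD(2)[of \<beta>1 J1 t1 t] assms t t1 t0 d by auto
  moreover have "u * h s0 + u * J2 \<le> u * h s"
    using jumpD(1)[of \<beta>2 J2 s0 s] assms s s1 s0 m by auto
  moreover have "w * (h t0 - h t) < u * J2"
    using d(3)[of t t0] t t0 w_pos by (simp add: field_simps)
  moreover have "u * (h s1 - h s) < w * J1"
    using s1(3)[of s s1] s u_pos by (simp add: field_simps)
  ultimately show False by (simp add: algebra_simps max_def split: if_splits)
qed

lemma continuous_if_no_jump:
  assumes "0 \<le> x" "x < 1" "\<And>J. \<not> jump x J"
  shows "continuous (at x within {0..1}) h"
  unfolding continuous_within_eps_delta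
proof (intro allI impI)
  fix e :: real assume e: "e > 0"
  \<comment> \<open>Failure of \<open>jump x e\<close> is a bracket around \<open>x\<close> over
    which \<open>h\<close> increases by less than \<open>e\<close>.\<close>
  then obtain a b where ab: "0 \<le> a" "a < x \<or> a = 0 \<and> x = 0" "x < b" "b \<le> 1" "h b - h a < e"
    using assms(3)[of e] by (auto simp: jump_def not_le)
  define d where "d = min (b - x) (if x = 0 then 1 else x - a)"
  have "d > 0" using ab assms by (auto simp: d_def)
  moreover have "dist (h y) (h x) < e" if "y \<in> {0..1}" "dist y x < d" for y
  proof -
    have "a \<le> y" "y \<le> b"
      using that ab assms by (auto simp: d_def dist_real_def split: if_splits)
    then have "h a \<le> h y" "h y \<le> h b" "h a \<le> h x" "h x \<le> h b"
      using ab assms by (auto intro!: h_mono)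
    then show ?thesis using ab(5) by (auto simp: dist_real_def)
  qed
  ultimately show "\<exists>d>0. \<forall>x'\<in>{0..1}. dist x' x < d \<longrightarrow> dist (h x') (h x) < e" by blast
qed

text \<open>Continuity on \<open>[a,b]\<close> lets an increase of \<open>h\<close> be cut down to a
  positive one of size at most \<open>e\<close>, as the size condition of the constancy lemmas at a
  jump demands.\<close>

lemma small_increment:
  assumes "0 \<le> a" "a < b" "b < 1" "h a < h b" "\<And>x J. a \<le> x \<Longrightarrow> x \<le> b \<Longrightarrow> \<not> jump x J" "0 < e"
  obtains x y where "a < x" "x < y" "y \<le> b" "h a < h x" "h y - h a \<le> e"
proof -
  have cont: "continuous_on {a..b} h"
    unfolding continuous_on_eq_continuous_within
  proof
    fix x assume "x \<in> {a..b}"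
    then have "continuous (at x within {0..1}) h"
      using assms by (intro continuous_if_no_jump) auto
    then show "continuous (at x within {a..b}) h"
      by (rule continuous_within_subset) (use assms in auto)
  qed
  define r where "r = min e (h b - h a)"
  have r: "0 < r" "r \<le> e" "r \<le> h b - h a" using assms by (auto simp: r_def)
  obtain y where y: "a \<le> y" "y \<le> b" "h y = h a + r"
    using IVT'[of h a "h a + r" b] cont assms r by auto
  obtain x where x: "a \<le> x" "x \<le> y" "h x = h a + r / 2"
    using IVT'[of h a "h a + r / 2" y] continuous_on_subset[OF cont, of "{a..y}"] y r by auto
  have "x \<noteq> a" "x \<noteq> y" using x y r by auto
  then show thesis using that[of x y] x y r by auto
qed

text \<open>There is no second jump, so \<open>small_increment\<close> applies on either side of
  \<open>\<beta>\<close>; the increment that it yields is one that \<open>jump_constant_left\<close>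
  or \<open>jump_constant_right\<close> rules out.\<close>

lemma jump_imp_step:
  assumes J: "jump \<beta> J" and b: "0 \<le> \<beta>" "\<beta> < 1"
  shows "\<And>x. 0 \<le> x \<Longrightarrow> x < \<beta> \<Longrightarrow> h x = h 0"
    and "\<And>x y. \<beta> < x \<Longrightarrow> x < 1 \<Longrightarrow> \<beta> < y \<Longrightarrow> y < 1 \<Longrightarrow> h x = h y"
proof -
  have Jp: "0 < J" using J by (simp add: jump_def)
  have no: "\<not> jump x J'" if "0 \<le> x" "x < 1" "x \<noteq> \<beta>" for x J'
    using no_two_jumps[of x J' \<beta> J] no_two_jumps[of \<beta> J x J'] that J b
    by (cases x \<beta> rule: linorder_cases) auto
  show "h x = h 0" if "0 \<le> x" "x < \<beta>" for x
  proof (rule ccontr)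
    assume "h x \<noteq> h 0"
    then have lt: "h 0 < h x" "0 < x" using h_mono[of 0 x] that b by (auto simp: less_le)
    have e0: "0 < u * J / w" using Jp u_pos w_pos by simp
    have nj: "\<not> jump z J'" if "0 \<le> z" "z \<le> x" for z J'
      by (rule no) (use that \<open>x < \<beta>\<close> b in auto)
    obtain z y where "0 < z" "z < y" "y \<le> x" "h 0 < h z" "h y - h 0 \<le> u * J / w"
      by (rule small_increment[OF order_refl lt(2) _ lt(1) nj e0]) (use \<open>x < \<beta>\<close> b in auto)
    then show False
      using jump_constant_left[OF J b(2), of 0 z y] that w_pos by (simp add: field_simps)
  qed
  have *: "\<not> h x < h y" if "\<beta> < x" "x \<le> y" "y < 1" for x y
  proof
    assume lt: "h x < h y"
    then have xy: "x < y" using that by (cases "x = y") auto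
    have nj: "\<not> jump z J'" if "x \<le> z" "z \<le> y" for z J'
      by (rule no) (use that \<open>\<beta> < x\<close> \<open>y < 1\<close> b in auto)
    have e0: "0 < w * J / u" using Jp u_pos w_pos by simp
    obtain q p where "x < q" "q < p" "p \<le> y" "h x < h q" "h p - h x \<le> w * J / u"
      by (rule small_increment[OF _ xy _ lt nj e0]) (use \<open>\<beta> < x\<close> \<open>y < 1\<close> b in auto)
    then show False
      using jump_constant_right[OF J b(1), of x q p] that u_pos by (simp add: field_simps)
  qed
  have "h x = h y" if "\<beta> < x" "x \<le> y" "y < 1" for x y
    using *[OF that] h_mono[of x y] that b by linarith
  then show "h x = h y" if "\<beta> < x" "x < 1" "\<beta> < y" "y < 1" for x y
    using that by (cases "x \<le> y") (auto, metis linear)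
qed

section \<open>Excluding concave behaviour of a continuous \<open>h\<close>\<close>

text \<open>At a concave kink \<open>m\<close> every slope in an open range supports \<open>h\<close> from above, so the direction of a
  segment through \<open>(m, t)\<close> can be adapted to a slope of \<open>h\<close> at another point \<open>t < m\<close>; then both
  ends of the segment lie strictly below its midpoint.\<close>

lemma no_concave_kink:
  assumes cont: "continuous_on {0..<1} h"
    and ab: "0 \<le> a" "a < m" "m < b" "b < 1"
    and sig: "0 < \<sigma>2" "\<sigma>2 < \<sigma>1"
    and sup1: "\<And>x. a \<le> x \<Longrightarrow> x \<le> b \<Longrightarrow> h x \<le> h m + \<sigma>1 * (x - m)"
    and sup2: "\<And>x. a \<le> x \<Longrightarrow> x \<le> b \<Longrightarrow> h x \<le> h m + \<sigma>2 * (x - m)"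
  shows False
proof -
  have cont': "continuous_on {a..x} h" if "x < 1" for x
    using cont by (rule continuous_on_subset) (use that ab in auto)
  have "h a \<le> h m + \<sigma>1 * (a - m)" using sup1[of a] ab by simp
  moreover have "\<sigma>1 * (a - m) < 0" using sig ab by (simp add: mult_less_0_iff)
  ultimately have ham: "h a < h m" by simp
  \<comment> \<open>Halving the rise twice gives \<open>a < p < q < m\<close> with strict increases,
    as \<open>continuous_slope_exists\<close> needs to find \<open>t < q\<close>.\<close>
  obtain q where q: "a \<le> q" "q \<le> m" "h q = (h a + h m) / 2"
    using IVT'[of h a "(h a + h m) / 2" m] cont'[of m] ab ham by auto
  then have qm: "q < m" "a < q" "h a < h q" using ham by (auto simp: less_le)
  obtain p where p: "a \<le> p" "p \<le> q" "h p = (h a + h q) / 2"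
    using IVT'[of h a "(h a + h q) / 2" q] cont'[of q] ab qm by auto
  then have pq: "p < q" "a < p" "h a < h p" using qm by (auto simp: less_le)
  have "mono_on {a..q} h" using mono_h by (rule mono_on_subset) (use ab qm in auto)
  moreover have "continuous_on {a..q} h" using cont'[of q] ab qm by simp
  ultimately obtain t \<tau> where t: "a < t" "t < q" "0 < \<tau>"
    and ev: "\<And>e. 0 < e \<Longrightarrow> \<forall>\<^sub>F y in at_right 0. h (t + y) - h t \<le> \<tau> * (1 + e) * y
       \<and> \<tau> * (1 - e) * y \<le> h t - h (t - y)"
    using continuous_slope_exists[of a q h p] qm pq by blast
  \<comment> \<open>This \<open>e\<close> leaves a gap between \<open>(1 + e) / \<sigma>1\<close>
    and \<open>(1 - e) / \<sigma>2\<close>. A step \<open>y\<close> in \<open>t\<close> is paired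
    with \<open>r * y\<close> in \<open>s\<close>, and \<open>K\<close> in that gap makes both ends
    lower than the midpoint.\<close>
  define e where "e = (\<sigma>1 - \<sigma>2) / (2 * (\<sigma>1 + \<sigma>2))"
  have e: "0 < e" using sig by (simp add: e_def)
  have "e * (\<sigma>1 + \<sigma>2) = (\<sigma>1 - \<sigma>2) / 2" using sig by (simp add: e_def divide_simps)
  then have "(1 + e) * \<sigma>2 < (1 - e) * \<sigma>1" using sig by (simp add: algebra_simps)
  then have "(1 + e) / \<sigma>1 < (1 - e) / \<sigma>2" using sig by (simp add: field_simps)
  then obtain K where K: "(1 + e) / \<sigma>1 < K" "K < (1 - e) / \<sigma>2" using dense by blast
  have "0 < (1 + e) / \<sigma>1" using e sig by simp
  then have Kp: "0 < K" using K by linarith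
  define r where "r = w * \<tau> * K / u"
  have r: "0 < r" using Kp t u_pos w_pos by (simp add: r_def)
  \<comment> \<open>For \<open>0 < y < d\<close> the points \<open>t - y\<close>,
    \<open>t + y\<close> stay in \<open>(a,q)\<close> and \<open>m - r * y\<close>,
    \<open>m + r * y\<close> in \<open>(q,b)\<close>.\<close>
  define d where "d = min (min (t - a) (q - t)) (min ((m - q) / r) ((b - m) / r))"
  have "0 < d" using t qm ab r by (simp add: d_def)
  then have "\<forall>\<^sub>F y in at_right 0. y \<in> {0<..<d}" by (rule eventually_at_right_real)
  then have "\<forall>\<^sub>F y in at_right 0. y \<in> {0<..<d} \<and> h (t + y) - h t \<le> \<tau> * (1 + e) * y
       \<and> \<tau> * (1 - e) * y \<le> h t - h (t - y)"
    using ev[OF e] by (rule eventually_conj)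
  then obtain y where y: "0 < y" "y < d" "h (t + y) - h t \<le> \<tau> * (1 + e) * y"
    "\<tau> * (1 - e) * y \<le> h t - h (t - y)"
    using eventually_happens[of _ "at_right (0::real)"] by (auto simp: trivial_limit_at_right_real)
  have bnd: "y < t - a" "y < q - t" "r * y < m - q" "r * y < b - m"
    using y(2) r by (auto simp: d_def field_simps)
  have ry: "0 < r * y" using r y by simp
  have "w * (h (t + y) - h t) \<le> w * (\<tau> * (1 + e) * y)" using y w_pos by simp
  also have "\<dots> = w * \<tau> * y * (1 + e)" by simp
  also have "\<dots> < w * \<tau> * y * (K * \<sigma>1)"
    using K sig w_pos t y by (intro mult_strict_left_mono) (auto simp: field_simps)
  also have "\<dots> = u * (\<sigma>1 * (r * y))" using u_pos by (simp add: r_def)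
  finally have 1: "w * (h (t + y) - h t) < u * (\<sigma>1 * (r * y))" .
  have "u * (\<sigma>2 * (r * y)) = w * \<tau> * y * (K * \<sigma>2)" using u_pos by (simp add: r_def)
  also have "\<dots> < w * \<tau> * y * (1 - e)"
    using K sig w_pos t y by (intro mult_strict_left_mono) (auto simp: field_simps)
  also have "\<dots> = w * (\<tau> * (1 - e) * y)" by simp
  also have "\<dots> \<le> w * (h t - h (t - y))" using y w_pos by simp
  finally have 2: "u * (\<sigma>2 * (r * y)) < w * (h t - h (t - y))" .
  have "h (m - r * y) \<le> h m - \<sigma>1 * (r * y)" using sup1[of "m - r * y"] bnd qm ry ab by simp
  then have 3: "u * h (m - r * y) \<le> u * (h m - \<sigma>1 * (r * y))" using u_pos by simp
  have "h (m + r * y) \<le> h m + \<sigma>2 * (r * y)" using sup2[of "m + r * y"] bnd qm ry ab by simp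
  then have 4: "u * h (m + r * y) \<le> u * (h m + \<sigma>2 * (r * y))" using u_pos by simp
  have "u * h m + w * h t \<le>
      max (u * h (m - r * y) + w * h (t + y)) (u * h (m + r * y) + w * h (t - y))"
    using quasiconvex_segment[of "t - y" "t + y" "m - r * y" "m + r * y" "1/2"] bnd ry y qm ab t
    by (simp add: field_simps)
  then show False using 1 2 3 4 by (simp add: algebra_simps max_def split: if_splits)
qed

text \<open>At \<open>(m2, m1)\<close> the ratio \<open>r\<close> of the steps makes the first-order
  changes \<open>u * \<sigma>2 * x\<close> and \<open>w * \<sigma>1 * r * x\<close> cancel. Each end
  of the segment has one coordinate to the left of its maximizer, where the support is strict, so
  both ends are strictly lower.\<close>

lemma no_two_supports:
  assumes ab: "0 \<le> a" "a < m1" "m1 < m2" "m2 < b" "b \<le> 1"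
    and sig: "0 < \<sigma>1" "0 < \<sigma>2"
    and sup1: "\<And>x. a \<le> x \<Longrightarrow> x \<le> b \<Longrightarrow> h x \<le> h m1 + \<sigma>1 * (x - m1)"
    and sup2: "\<And>x. a \<le> x \<Longrightarrow> x \<le> b \<Longrightarrow> h x \<le> h m2 + \<sigma>2 * (x - m2)"
    and left1: "\<And>x. a \<le> x \<Longrightarrow> x < m1 \<Longrightarrow> h x < h m1 + \<sigma>1 * (x - m1)"
    and left2: "\<And>x. a \<le> x \<Longrightarrow> x < m2 \<Longrightarrow> h x < h m2 + \<sigma>2 * (x - m2)"
  shows False
proof -
  define r where "r = u * \<sigma>2 / (w * \<sigma>1)"
  have r: "0 < r" "w * (\<sigma>1 * (r * x)) = u * (\<sigma>2 * x)" for x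
    using sig u_pos w_pos by (auto simp: r_def)
  \<comment> \<open>The choice of \<open>d\<close> and \<open>x\<close> gives
    \<open>m1 + r * x \<le> m2 - x\<close>, which keeps the segment in the domain, and places all
    coordinates between \<open>a\<close> and \<open>b\<close>.\<close>
  define d where "d = min ((m2 - m1) / 2) (b - m2)"
  define x where "x = min d (min ((m2 - m1) / (2 * r)) ((m1 - a) / r))"
  have x: "0 < x" "x \<le> (m2 - m1) / 2" "x \<le> b - m2" "x \<le> (m2 - m1) / (2 * r)" "x \<le> (m1 - a) / r"
  proof -
    have "x \<le> d" unfolding x_def by simp
    then show "x \<le> (m2 - m1) / 2" "x \<le> b - m2" unfolding d_def by linarith+
    show "x \<le> (m2 - m1) / (2 * r)" "x \<le> (m1 - a) / r" unfolding x_def by linarith+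
    show "0 < x" using r(1) ab by (simp add: x_def d_def)
  qed
  then have bnd: "r * x \<le> (m2 - m1) / 2" "r * x \<le> m1 - a" "0 < r * x"
    using r(1) pos_le_divide_eq[of "2 * r" x "m2 - m1"] pos_le_divide_eq[of r x "m1 - a"]
    by (auto simp: algebra_simps)
  have "h (m2 - x) < h m2 - \<sigma>2 * x" using left2[of "m2 - x"] x bnd ab by simp
  then have 1: "u * h (m2 - x) < u * (h m2 - \<sigma>2 * x)" using u_pos by simp
  have "h (m2 + x) \<le> h m2 + \<sigma>2 * x" using sup2[of "m2 + x"] x bnd ab by simp
  then have 2: "u * h (m2 + x) \<le> u * (h m2 + \<sigma>2 * x)" using u_pos by simp
  have "h (m1 - r * x) < h m1 - \<sigma>1 * (r * x)" using left1[of "m1 - r * x"] x bnd ab by simp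
  then have 3: "w * h (m1 - r * x) < w * (h m1 - \<sigma>1 * (r * x))" using w_pos by simp
  have "h (m1 + r * x) \<le> h m1 + \<sigma>1 * (r * x)" using sup1[of "m1 + r * x"] x bnd ab by simp
  then have 4: "w * h (m1 + r * x) \<le> w * (h m1 + \<sigma>1 * (r * x))" using w_pos by simp
  have "u * h m2 + w * h m1 \<le>
      max (u * h (m2 - x) + w * h (m1 + r * x)) (u * h (m2 + x) + w * h (m1 - r * x))"
    using quasiconvex_segment[of "m1 - r * x" "m1 + r * x" "m2 - x" "m2 + x" "1/2"] bnd x ab
    by (simp add: field_simps)
  then show False using 1 2 3 4 r(2)[of x]
    by (simp add: right_diff_distrib distrib_left max_def split: if_splits)
qed

text \<open>If \<open>h z\<close> lies above the chord, then subtracting a line of slope slightly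
  above \<open>\<sigma>0\<close> still leaves an interior maximum; two such slopes contradict one of
  the two preceding exclusions.\<close>

lemma continuous_imp_chord:
  assumes cont: "continuous_on {0..<1} h" and "0 \<le> a" "a < b" "b < 1" "0 < l" "l < 1"
  shows "h ((1 - l) * a + l * b) \<le> (1 - l) * h a + l * h b"
proof (rule ccontr)
  define z where "z = (1 - l) * a + l * b"
  assume "\<not> h ((1 - l) * a + l * b) \<le> (1 - l) * h a + l * h b"
  then have neg: "(1 - l) * h a + l * h b < h z" by (simp add: z_def)
  define \<sigma>0 where "\<sigma>0 = (h b - h a) / (b - a)"
  have s0: "\<sigma>0 * (b - a) = h b - h a" using assms by (simp add: \<sigma>0_def)
  have s0n: "0 \<le> \<sigma>0" using h_mono[of a b] assms by (simp add: \<sigma>0_def)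
  have za: "z - a = l * (b - a)" by (simp add: z_def algebra_simps)
  have "0 < l * (b - a)" "l * (b - a) < b - a" using assms by auto
  then have zab: "a < z" "z < b" using za by auto
  have "\<sigma>0 * (z - a) = l * (h b - h a)" unfolding za using s0 by (metis mult.left_commute)
  then have ga: "\<sigma>0 * (z - a) < h z - h a" using neg by (simp add: algebra_simps)
  then have gb: "\<sigma>0 * (z - b) < h z - h b" using s0 by (simp add: algebra_simps)
  \<comment> \<open>\<open>e\<close> is the excess of the slope from \<open>a\<close> to
    \<open>z\<close> over \<open>\<sigma>0\<close>; for \<open>\<sigma>\<close> between
    \<open>\<sigma>0\<close> and \<open>\<sigma>0 + e\<close> the value of
    \<open>h x - \<sigma> * x\<close> at \<open>z\<close> exceeds those at both endpoints.\<close>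
  define e where "e = (h z - h a - \<sigma>0 * (z - a)) / (z - a)"
  have e: "0 < e" "e * (z - a) = h z - h a - \<sigma>0 * (z - a)" using ga zab by (auto simp: e_def)
  have max: "\<exists>m. a < m \<and> m < b \<and> (\<forall>x. a \<le> x \<longrightarrow> x \<le> b \<longrightarrow> h x \<le> h m + \<sigma> * (x - m))
      \<and> (\<forall>x. a \<le> x \<longrightarrow> x < m \<longrightarrow> h x < h m + \<sigma> * (x - m))"
    if s: "\<sigma>0 < \<sigma>" "\<sigma> < \<sigma>0 + e" for \<sigma>
  proof -
    have "\<sigma> * (z - a) < (\<sigma>0 + e) * (z - a)" using s zab by simp
    then have 1: "h a - \<sigma> * a < h z - \<sigma> * z" using e by (simp add: algebra_simps)
    have "\<sigma> * (z - b) \<le> \<sigma>0 * (z - b)" using s zab by (simp add: mult_right_mono_neg)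
    then have 2: "h b - \<sigma> * b < h z - \<sigma> * z" using gb by (simp add: algebra_simps)
    have "continuous_on {a..b} (\<lambda>x. h x - \<sigma> * x)"
      by (intro continuous_intros continuous_on_subset[OF cont]) (use assms in auto)
    then obtain m where "a < m" "m < b"
      "\<And>x. a \<le> x \<Longrightarrow> x \<le> b \<Longrightarrow> h x - \<sigma> * x \<le> h m - \<sigma> * m"
      "\<And>x. a \<le> x \<Longrightarrow> x < m \<Longrightarrow> h x - \<sigma> * x < h m - \<sigma> * m"
      using smallest_maximizer[of a b "\<lambda>x. h x - \<sigma> * x" z] 1 2 zab by auto
    then show ?thesis by (intro exI[of _ m]) (auto simp: algebra_simps)
  qed
  define \<sigma>1 \<sigma>2 where "\<sigma>1 = \<sigma>0 + e / 2" and "\<sigma>2 = \<sigma>0 + e / 3"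
  have s: "0 < \<sigma>2" "\<sigma>2 < \<sigma>1" "\<sigma>0 < \<sigma>1" "\<sigma>1 < \<sigma>0 + e" "\<sigma>0 < \<sigma>2" "\<sigma>2 < \<sigma>0 + e"
    using e s0n by (auto simp: \<sigma>1_def \<sigma>2_def)
  obtain m1 where m1: "a < m1" "m1 < b"
    and sup1: "\<And>x. a \<le> x \<Longrightarrow> x \<le> b \<Longrightarrow> h x \<le> h m1 + \<sigma>1 * (x - m1)"
    and left1: "\<And>x. a \<le> x \<Longrightarrow> x < m1 \<Longrightarrow> h x < h m1 + \<sigma>1 * (x - m1)"
    using max[OF s(3,4)] by blast
  obtain m2 where m2: "a < m2" "m2 < b"
    and sup2: "\<And>x. a \<le> x \<Longrightarrow> x \<le> b \<Longrightarrow> h x \<le> h m2 + \<sigma>2 * (x - m2)"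
    and left2: "\<And>x. a \<le> x \<Longrightarrow> x < m2 \<Longrightarrow> h x < h m2 + \<sigma>2 * (x - m2)"
    using max[OF s(5,6)] by blast
  \<comment> \<open>The support inequality of each maximizer, taken at the other one, shows that the
    smaller slope does not have its maximizer further left.\<close>
  have "0 \<le> (\<sigma>1 - \<sigma>2) * (m2 - m1)"
    using sup1[of m2] sup2[of m1] m1 m2 by (simp add: algebra_simps)
  then have "m1 \<le> m2" using s by (simp add: zero_le_mult_iff)
  then consider "m1 = m2" | "m1 < m2" by linarith
  then show False
  proof cases
    case 1
    show False
      by (rule no_concave_kink[OF cont, of a m1 b \<sigma>2 \<sigma>1]) (use assms m1 s sup1 sup2 1 in auto)
  next
    case 2
    show False
      by (rule no_two_supports[of a m1 m2 b \<sigma>1 \<sigma>2])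
        (use assms m1 m2 s sup1 sup2 left1 left2 2 in auto)
  qed
qed

text \<open>Only chords ending at 1 remain, where \<open>h\<close> may jump: the chord inequality
  passes to the limit at the inner point, where \<open>h\<close> is continuous, and
  \<open>h b \<le> h 1\<close> handles the end.\<close>

lemma continuous_imp_convex:
  assumes cont: "continuous_on {0..<1} h"
  shows "convex_on {0..1} h"
proof (rule convex_on_linorderI)
  fix l x y :: real
  assume l: "0 < l" "l < 1" and xy: "x \<in> {0..1}" "y \<in> {0..1}" "x < y"
  define z where "z b = (1 - l) * x + l * b" for b
  have "h (z y) \<le> (1 - l) * h x + l * h y"
  proof (cases "y < 1")
    case True
    then show ?thesis unfolding z_def by (intro continuous_imp_chord cont) (use l xy in auto)
  next
    case False
    then have y: "y = 1" using xy by auto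
    have zb: "0 \<le> z b \<and> z b < 1" if "x < b" "b \<le> 1" for b
    proof -
      have "l * b \<le> l * 1" "(1 - l) * x < (1 - l) * 1" "0 \<le> (1 - l) * x" "0 \<le> l * b"
        using that l xy y by (auto intro!: mult_left_mono mult_strict_left_mono)
      then show ?thesis by (auto simp: z_def)
    qed
    have "((\<lambda>b. h (z b)) \<longlongrightarrow> h (z 1)) (at_left 1)"
    proof -
      have "isCont h (z 1)"
      proof (cases "z 1 = 0")
        case True
        moreover have "0 \<le> (1 - l) * x" using l xy by simp
        ultimately have "0 < z 1" unfolding z_def using l by linarith
        then show ?thesis using True by simp
      next
        case False
        then have "z 1 \<in> {0<..<1}" using zb[of 1] xy y by auto
        moreover have "continuous_on {0<..<1} h" using cont by (rule continuous_on_subset) auto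
        ultimately show ?thesis by (simp add: continuous_on_eq_continuous_at)
      qed
      moreover have "(z \<longlongrightarrow> z 1) (at_left 1)" unfolding z_def by (intro tendsto_intros)
      ultimately show ?thesis by (rule isCont_tendsto_compose)
    qed
    moreover have "\<forall>\<^sub>F b in at_left 1. h (z b) \<le> (1 - l) * h x + l * h y"
    proof -
      have "\<forall>\<^sub>F b in at_left 1. b \<in> {x<..<1}"
        by (rule eventually_at_left_real) (use xy y in auto)
      then show ?thesis
      proof eventually_elim
        case (elim b)
        have "h (z b) \<le> (1 - l) * h x + l * h b"
          unfolding z_def by (rule continuous_imp_chord[OF cont]) (use elim l xy in auto)
        moreover have "l * h b \<le> l * h y" using elim l xy y by (intro mult_left_mono h_mono) auto
        ultimately show ?case by linarith
      qed
    qed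
    ultimately show ?thesis unfolding y by (intro tendsto_upperbound) auto
  qed
  then show "h ((1 - l) *\<^sub>R x + l *\<^sub>R y) \<le> (1 - l) * h x + l * h y" by (simp add: z_def)
qed auto

lemma convex_or_step:
  "convex_on {0..1} h \<or> (\<exists>\<beta>. 0 \<le> \<beta> \<and> \<beta> < 1 \<and> (\<forall>x. 0 \<le> x \<longrightarrow> x < \<beta> \<longrightarrow> h x = h 0)
     \<and> (\<forall>x y. \<beta> < x \<longrightarrow> x < 1 \<longrightarrow> \<beta> < y \<longrightarrow> y < 1 \<longrightarrow> h x = h y))"
proof (cases "\<exists>\<beta> J. 0 \<le> \<beta> \<and> \<beta> < 1 \<and> jump \<beta> J")
  case True
  then show ?thesis using jump_imp_step by blast
next
  case False
  have "continuous_on {0..<1} h"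
    unfolding continuous_on_eq_continuous_within
  proof
    fix x :: real assume "x \<in> {0..<1}"
    then have "continuous (at x within {0..1}) h"
      using False by (intro continuous_if_no_jump) auto
    then show "continuous (at x within {0..<1}) h"
      by (rule continuous_within_subset) auto
  qed
  then show ?thesis using continuous_imp_convex by blast
qed

end

section \<open>Rank-dependent functionals and quantiles\<close>

lemma compactly_supportedE:
  assumes "F \<in> compactly_supported"
  obtains b where "0 \<le> b" "measure F {-b..b} = 1"
proof -
  interpret real_distribution F using assms by (simp add: compactly_supported_def)
  obtain K where K: "compact K" "measure F K = 1" using assms by (auto simp: compactly_supported_def)
  then obtain b where b: "0 < b" "\<And>x. x \<in> K \<Longrightarrow> \<bar>x\<bar> \<le> b"
    using compact_imp_bounded[OF K(1)] by (auto simp: bounded_pos)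
  then have "K \<subseteq> {-b..b}" by (force simp: abs_le_iff)
  then have "measure F K \<le> measure F {-b..b}" by (intro finite_measure_mono) auto
  then have "measure F {-b..b} = 1" using K prob_le_1[of "{-b..b}"] by linarith
  then show thesis using that[of b] b by simp
qed

lemma support_mono:
  assumes "real_distribution F" "measure F {a..b} = 1" "a' \<le> a" "b \<le> b'"
  shows "measure F {a'..b'} = 1"
proof -
  interpret real_distribution F by fact
  have "measure F {a..b} \<le> measure F {a'..b'}" using assms by (intro finite_measure_mono) auto
  then show ?thesis using assms prob_le_1[of "{a'..b'}"] by linarith
qed

lemma compactly_supported_pairE:
  assumes "F \<in> compactly_supported" "G \<in> compactly_supported"
  obtains b where "0 \<le> b" "measure F {-b..b} = 1" "measure G {-b..b} = 1"
proof -
  obtain b1 where b1: "0 \<le> b1" "measure F {-b1..b1} = 1" using assms compactly_supportedE by blast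
  obtain b2 where b2: "0 \<le> b2" "measure G {-b2..b2} = 1" using assms compactly_supportedE by blast
  show thesis
  proof (rule that)
    show "0 \<le> max b1 b2" using b1 by simp
    show "measure F {- max b1 b2..max b1 b2} = 1"
      by (rule support_mono[OF _ b1(2)]) (use assms in \<open>auto simp: compactly_supported_def\<close>)
    show "measure G {- max b1 b2..max b1 b2} = 1"
      by (rule support_mono[OF _ b2(2)]) (use assms in \<open>auto simp: compactly_supported_def\<close>)
  qed
qed

lemma survival_outside_support:
  assumes "real_distribution F" "measure F {a..b} = 1"
  shows "b \<le> x \<Longrightarrow> measure F {x<..} = 0" "x < a \<Longrightarrow> measure F {x<..} = 1"
proof -
  interpret real_distribution F by fact
  show "measure F {x<..} = 0" if "b \<le> x"
  proof -
    have "measure F ({a..b} \<union> {x<..}) = measure F {a..b} + measure F {x<..}"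
      by (rule finite_measure_Union) (use that in auto)
    then show ?thesis
      using assms(2) prob_le_1[of "{a..b} \<union> {x<..}"] measure_nonneg[of F "{x<..}"] by linarith
  qed
  show "measure F {x<..} = 1" if "x < a"
  proof -
    have "measure F {a..b} \<le> measure F {x<..}" by (intro finite_measure_mono) (use that in auto)
    then show ?thesis using assms(2) prob_le_1[of "{x<..}"] by linarith
  qed
qed

lemma survival_eq_cdf:
  assumes "real_distribution F"
  shows "measure F {x<..} = 1 - cdf F x"
proof -
  interpret real_distribution F by fact
  have "measure F (space F - {..x}) = 1 - measure F {..x}" by (rule prob_compl) auto
  moreover have "space F - {..x} = {x<..}" by auto
  ultimately show ?thesis by (simp add: cdf_def)
qed

lemma survival_in_unit: "real_distribution F \<Longrightarrow> measure F {x<..} \<in> {0..1}"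
  by (auto simp: real_distribution_def prob_space.prob_le_1)

lemma borel_measurable_distorted_survival:
  assumes "h \<in> H_DT" "real_distribution F"
  shows "(\<lambda>x. h (measure F {x<..})) \<in> borel_measurable borel"
proof -
  interpret real_distribution F by fact
  have "mono (\<lambda>x. - h (measure F {x<..}))"
  proof (rule monoI)
    fix x y :: real assume "x \<le> y"
    then have "measure F {y<..} \<le> measure F {x<..}" by (intro finite_measure_mono) auto
    then show "- h (measure F {x<..}) \<le> - h (measure F {y<..})"
      using assms survival_in_unit[OF assms(2)] by (auto simp: H_DT_def mono_on_def)
  qed
  then have "(\<lambda>x. - h (measure F {x<..})) \<in> borel_measurable borel"
    by (rule borel_measurable_mono)
  then have "(\<lambda>x. - (- h (measure F {x<..}))) \<in> borel_measurable borel"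
    by (rule borel_measurable_uminus)
  then show ?thesis by simp
qed

lemma set_integrable_bounded_interval:
  fixes f :: "real \<Rightarrow> real"
  assumes "f \<in> borel_measurable borel" "\<And>x. \<bar>f x\<bar> \<le> C"
  shows "set_integrable lborel {a..b} f"
  unfolding set_integrable_def
  by (rule integrableI_bounded_set_indicator[where B = C])
    (use assms in \<open>auto simp: emeasure_lborel_Icc_eq\<close>)

lemma set_integrable_distorted_survival:
  assumes "h \<in> H_DT" "real_distribution F"
  shows "set_integrable lborel {a..b} (\<lambda>x. h (measure F {x<..}))"
proof (rule set_integrable_bounded_interval[where C = 1])
  fix x
  let ?s = "measure F {x<..}"
  have "h 0 \<le> h ?s" "h ?s \<le> h 1"
    using assms(1) survival_in_unit[OF assms(2), of x]
      mono_onD[of "{0..1}" h 0 ?s] mono_onD[of "{0..1}" h ?s 1]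
    by (auto simp: H_DT_def)
  then show "\<bar>h ?s\<bar> \<le> 1" using assms(1) by (auto simp: H_DT_def)
qed (use assms borel_measurable_distorted_survival in auto)

text \<open>Both integrands vanish outside \<open>[-b,b]\<close>, and \<open>h 1 = 1\<close>
  integrates to \<open>b\<close> over \<open>[-b,0]\<close>.\<close>

lemma I_fun_eq:
  assumes h: "h \<in> H_DT" and F: "real_distribution F" and b: "0 \<le> b" "measure F {-b..b} = 1"
  shows "I_fun h F = (LBINT x:{-b..b}. h (measure F {x<..})) - b"
proof -
  let ?f = "\<lambda>x. h (measure F {x<..})"
  have h01: "h 0 = 0" "h 1 = 1" using h by (auto simp: H_DT_def)
  note int = set_integrable_distorted_survival[OF h F]
  have "(LBINT x:{0..}. ?f x) = (LBINT x:{0..b}. ?f x)"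
    unfolding set_lebesgue_integral_def
    by (intro Bochner_Integration.integral_cong)
      (auto simp: h01 survival_outside_support[OF F b(2)] split: split_indicator)
  moreover have "(LBINT x:{..0}. ?f x - h 1) = (LBINT x:{-b..0}. ?f x - 1)"
    unfolding set_lebesgue_integral_def
    by (intro Bochner_Integration.integral_cong)
      (auto simp: h01 survival_outside_support[OF F b(2)] split: split_indicator)
  moreover have "(LBINT x:{-b..0}. ?f x - 1) = (LBINT x:{-b..0}. ?f x) - (LBINT x:{-b..0}. 1)"
    by (rule set_integral_diff) (auto intro!: int set_integrable_bounded_interval[where C = 1])
  moreover have "(LBINT x:{-b..0}. 1) = b"
    using b by (simp add: set_lebesgue_integral_def)
  moreover have "(LBINT x:{-b..0} \<union> {0..b}. ?f x) = (LBINT x:{-b..0}. ?f x) + (LBINT x:{0..b}. ?f x)"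
  proof (rule set_integral_Un_AE)
    show "AE x in lborel. \<not> (x \<in> {-b..0} \<and> x \<in> {0..b})"
      using AE_lborel_singleton[of "0::real"] by eventually_elim auto
  qed (auto intro: int)
  moreover have "{-b..0} \<union> {0..b} = {-b..b}" using b by auto
  ultimately show ?thesis by (simp add: I_fun_def)
qed

section \<open>Mixtures and push-forwards\<close>

lemma measure_mixture:
  assumes "real_distribution F" "real_distribution G" "l \<in> {0..1}" "A \<in> sets borel"
  shows "measure (mixture l F G) A = l * measure F A + (1 - l) * measure G A"
proof -
  interpret F: real_distribution F by fact
  interpret G: real_distribution G by fact
  have "emeasure (mixture l F G) A = ennreal (l * measure F A + (1 - l) * measure G A)"
    using assms by (simp add: emeasure_mixture F.emeasure_eq_measure G.emeasure_eq_measure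
        ennreal_mult' ennreal_plus)
  then show ?thesis
    using assms by (intro measure_eq_emeasure_eq_ennreal) auto
qed

text \<open>Weights 0 and 1 are treated separately because the quantile bounds for mixtures need
  both weights to be positive.\<close>

lemma mixture_endpoints:
  assumes "real_distribution F" "real_distribution G"
  shows "mixture 0 F G = G" "mixture 1 F G = F"
proof -
  have "measure_of UNIV (sets borel) (emeasure H) = H" if "real_distribution H" for H :: "real measure"
    using that measure_of_of_measure[of H]
    by (simp add: real_distribution.space_eq_univ real_distribution.events_eq_borel)
  then show "mixture 0 F G = G" "mixture 1 F G = F"
    using assms by (simp_all add: mixture_def)
qed

lemma mixture_commute: "mixture l F G = mixture (1 - l) G F"
  by (simp add: mixture_def add.commute)

lemma mixture_compactly_supported:
  assumes "F \<in> compactly_supported" "G \<in> compactly_supported" "l \<in> {0..1}"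
  shows "mixture l F G \<in> compactly_supported"
proof -
  have rd: "real_distribution F" "real_distribution G"
    using assms by (auto simp: compactly_supported_def)
  obtain b where b: "measure F {-b..b} = 1" "measure G {-b..b} = 1"
    using compactly_supported_pairE[OF assms(1,2)] by blast
  have "measure (mixture l F G) {-b..b} = 1"
    using b measure_mixture[OF rd assms(3), of "{-b..b}"] by simp
  then show ?thesis
    using real_distribution_mixture[OF rd assms(3)] compact_Icc
    by (auto simp: compactly_supported_def simp del: compact_Icc)
qed

lemma distr_mixture:
  assumes "real_distribution F" "real_distribution G" "l \<in> {0..1}" "v \<in> borel_measurable borel"
  shows "distr (mixture l F G) borel v = mixture l (distr F borel v) (distr G borel v)"
proof -
  interpret F: real_distribution F by fact
  interpret G: real_distribution G by fact
  interpret M: real_distribution "mixture l F G" by (rule real_distribution_mixture) fact+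
  interpret D: real_distribution "mixture l (distr F borel v) (distr G borel v)"
    by (rule real_distribution_mixture) (use assms in auto)
  show ?thesis
  proof (rule measure_eqI)
    fix A assume "A \<in> sets (distr (mixture l F G) borel v)"
    then have A: "A \<in> sets borel" by simp
    then have "v -` A \<in> sets borel" using measurable_sets[OF assms(4)] by simp
    then show "emeasure (distr (mixture l F G) borel v) A
        = emeasure (mixture l (distr F borel v) (distr G borel v)) A"
      using A assms by (simp add: emeasure_distr emeasure_mixture)
  qed simp
qed

text \<open>An increasing \<open>v\<close> maps \<open>[-b,b]\<close> into
  \<open>[v (-b), v b]\<close>, even if it is discontinuous.\<close>

lemma distr_compactly_supported:
  assumes "F \<in> compactly_supported" "mono v"
  shows "distr F borel v \<in> compactly_supported"
proof -
  interpret real_distribution F using assms by (simp add: compactly_supported_def)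
  have v: "v \<in> borel_measurable borel" using assms borel_measurable_mono by blast
  then have rd: "real_distribution (distr F borel v)" by simp
  obtain b where b: "measure F {-b..b} = 1" using compactly_supportedE[OF assms(1)] by blast
  have "v -` {v (-b)..v b} \<in> sets borel" using measurable_sets[OF v] by simp
  then have "measure F {-b..b} \<le> measure F (v -` {v (-b)..v b})"
    by (intro finite_measure_mono) (use assms in \<open>auto dest: monoD\<close>)
  also have "\<dots> = measure (distr F borel v) {v (-b)..v b}" using v by (simp add: measure_distr)
  finally have "measure (distr F borel v) {v (-b)..v b} = 1"
    using b prob_space.prob_le_1[of "distr F borel v" "{v (-b)..v b}"] rd
    by (auto simp: real_distribution_def)
  then show ?thesis using rd compact_Icc by (auto simp: compactly_supported_def simp del: compact_Icc)
qed

text \<open>Push-forward commutes with mixtures but may leave \<open>M\<close>, so the hypothesis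
  concerns the whole class \<open>compactly_supported\<close>.\<close>

lemma p_quasi_convex_on_R_fun:
  assumes "p_quasi_convex_on compactly_supported (I_fun h)" "M \<subseteq> compactly_supported" "mono v"
  shows "p_quasi_convex_on M (R_fun h v)"
  unfolding p_quasi_convex_on_def R_fun_def
proof (intro ballI)
  fix F G and l :: real assume FG: "F \<in> M" "G \<in> M" and l: "l \<in> {0..1}"
  then have "distr F borel v \<in> compactly_supported" "distr G borel v \<in> compactly_supported"
    using assms by (auto intro: distr_compactly_supported)
  moreover have "distr (mixture l F G) borel v = mixture l (distr F borel v) (distr G borel v)"
    using FG l assms
    by (intro distr_mixture) (auto simp: compactly_supported_def borel_measurable_mono)
  ultimately show "I_fun h (distr (mixture l F G) borel v)
      \<le> max (I_fun h (distr F borel v)) (I_fun h (distr G borel v))"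
    using assms(1) l by (simp add: p_quasi_convex_on_def)
qed

lemma R_fun_id:
  assumes "real_distribution F"
  shows "R_fun h (\<lambda>x. x) F = I_fun h F"
proof -
  interpret real_distribution F by fact
  have "distr F borel (\<lambda>x. x) = F" by (rule distr_id2) simp
  then show ?thesis by (simp add: R_fun_def)
qed

text \<open>The survival function of a mixture is the mixture of the survival functions, so the
  convexity inequality for \<open>h\<close> can be integrated over a common support
  interval.\<close>

lemma convex_imp_p_quasi_convex:
  assumes h: "h \<in> H_DT" and conv: "convex_on {0..1} h"
  shows "p_quasi_convex_on compactly_supported (I_fun h)"
  unfolding p_quasi_convex_on_def
proof (intro ballI)
  fix F G and l :: real
  assume FG: "F \<in> compactly_supported" "G \<in> compactly_supported" and l: "l \<in> {0..1}"
  have rd: "real_distribution F" "real_distribution G"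
    using FG by (auto simp: compactly_supported_def)
  note rdm = real_distribution_mixture[OF rd l]
  obtain b where b: "0 \<le> b" "measure F {-b..b} = 1" "measure G {-b..b} = 1"
    using compactly_supported_pairE[OF FG] by blast
  have bm: "measure (mixture l F G) {-b..b} = 1"
    using b measure_mixture[OF rd l, of "{-b..b}"] by simp
  have int: "set_integrable lborel {-b..b} (\<lambda>x. c * h (measure H {x<..}))"
    if "real_distribution H" for c H
    using set_integrable_distorted_survival[OF h that] by simp
  have "(LBINT x:{-b..b}. h (measure (mixture l F G) {x<..}))
      \<le> (LBINT x:{-b..b}. l * h (measure F {x<..}) + (1 - l) * h (measure G {x<..}))"
  proof (rule set_integral_mono)
    show "set_integrable lborel {-b..b} (\<lambda>x. h (measure (mixture l F G) {x<..}))"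
      by (rule set_integrable_distorted_survival[OF h rdm])
    show "set_integrable lborel {-b..b} (\<lambda>x. l * h (measure F {x<..}) + (1 - l) * h (measure G {x<..}))"
      by (intro set_integral_add int rd)
    fix x
    have "h (l *\<^sub>R measure F {x<..} + (1 - l) *\<^sub>R measure G {x<..})
        \<le> l * h (measure F {x<..}) + (1 - l) * h (measure G {x<..})"
      using conv l survival_in_unit[OF rd(1)] survival_in_unit[OF rd(2)]
      unfolding convex_on_def by auto
    then show "h (measure (mixture l F G) {x<..})
        \<le> l * h (measure F {x<..}) + (1 - l) * h (measure G {x<..})"
      by (simp add: measure_mixture[OF rd l])
  qed
  also have "\<dots> = l * (LBINT x:{-b..b}. h (measure F {x<..}))
      + (1 - l) * (LBINT x:{-b..b}. h (measure G {x<..}))"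
    by (simp add: set_integral_add int rd)
  finally have "I_fun h (mixture l F G) \<le> l * I_fun h F + (1 - l) * I_fun h G"
    by (simp add: I_fun_eq[OF h rd(1) b(1,2)] I_fun_eq[OF h rd(2) b(1,3)] I_fun_eq[OF h rdm b(1) bm]
        algebra_simps)
  also have "\<dots> \<le> max (I_fun h F) (I_fun h G)"
    using l by (intro convex_bound_le) auto
  finally show "I_fun h (mixture l F G) \<le> max (I_fun h F) (I_fun h G)" .
qed

section \<open>Quantiles of mixtures\<close>

text \<open>Every quantile is the infimum of the set where the distribution function satisfies some
  upward closed condition on levels; \<open>L\<close> stands for this condition.\<close>

context
  fixes L :: "real \<Rightarrow> bool"
  assumes L_up: "\<And>p q. p \<le> q \<Longrightarrow> L p \<Longrightarrow> L q" and L1: "L 1" and L0: "\<not> L 0"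
begin

lemma cdf_outside_support:
  assumes "real_distribution F" "measure F {-b..b} = 1"
  shows "L (cdf F b)" "x < -b \<Longrightarrow> \<not> L (cdf F x)"
  using survival_outside_support[OF assms] survival_eq_cdf[OF assms(1)] L0 L1 by auto

lemma level_above_quantile:
  assumes "F \<in> compactly_supported" "Inf {x. L (cdf F x)} < x"
  shows "L (cdf F x)"
proof -
  interpret real_distribution F using assms by (simp add: compactly_supported_def)
  obtain b where b: "measure F {-b..b} = 1" using compactly_supportedE[OF assms(1)] by blast
  have "L (cdf F b)" by (rule cdf_outside_support[OF _ b]) unfold_locales
  then have "{x. L (cdf F x)} \<noteq> {}" by blast
  then obtain y where "y < x" "L (cdf F y)" using cInf_lessD[OF _ assms(2)] by auto
  then show ?thesis using L_up cdf_nondecreasing[of y x] by auto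
qed

lemma quantile_le_level:
  assumes "F \<in> compactly_supported" "L (cdf F x)"
  shows "Inf {x. L (cdf F x)} \<le> x"
proof -
  interpret real_distribution F using assms by (simp add: compactly_supported_def)
  obtain b where b: "measure F {-b..b} = 1" using compactly_supportedE[OF assms(1)] by blast
  have "\<not> L (cdf F x)" if "x < -b" for x
    by (rule cdf_outside_support(2)[OF _ b that]) unfold_locales
  then have "bdd_below {x. L (cdf F x)}" by (intro bdd_belowI[of _ "-b"]) (auto simp: not_less[symmetric])
  then show ?thesis using assms by (intro cInf_lower) auto
qed

lemma quantile_le:
  assumes "F \<in> compactly_supported" "\<And>x. q < x \<Longrightarrow> L (cdf F x)"
  shows "Inf {x. L (cdf F x)} \<le> q"
  by (rule dense_ge) (use assms quantile_le_level in blast)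

lemma quantile_bounds:
  assumes "F \<in> compactly_supported" "measure F {-b..b} = 1"
  shows "-b \<le> Inf {x. L (cdf F x)}" "Inf {x. L (cdf F x)} \<le> b"
proof -
  have F: "real_distribution F" using assms by (simp add: compactly_supported_def)
  show "Inf {x. L (cdf F x)} \<le> b"
    using quantile_le_level[OF assms(1)] cdf_outside_support(1)[OF F assms(2)] by blast
  show "-b \<le> Inf {x. L (cdf F x)}"
  proof (rule ccontr)
    assume "\<not> -b \<le> Inf {x. L (cdf F x)}"
    then obtain y where "Inf {x. L (cdf F x)} < y" "y < -b" using dense[of "Inf {x. L (cdf F x)}" "-b"] by auto
    then show False
      using level_above_quantile[OF assms(1)] cdf_outside_support(2)[OF F assms(2)] by blast
  qed
qed

end

text \<open>Membership of \<open>q\<close> in \<open>J\<close> is left open, as a single point has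
  measure zero; this treats strict and non-strict level conditions together.\<close>

lemma integral_indicator_lower_set:
  assumes "{..<q} \<subseteq> J" "J \<subseteq> {..q::real}" "-b \<le> q" "q \<le> b"
  shows "set_integrable lborel {-b..b} (indicator J :: real \<Rightarrow> real)"
    and "(LBINT x:{-b..b}. indicator J x) = q + b"
proof -
  have J: "J = {..<q} \<or> J = {..q}" using assms by (auto simp: subset_iff) (metis less_le)
  then have [measurable]: "J \<in> sets borel" by auto
  show "set_integrable lborel {-b..b} (indicator J :: real \<Rightarrow> real)"
    by (rule set_integrable_bounded_interval[where C = 1]) auto
  have "(LBINT x:{-b..b}. indicator J x) = measure lborel ({-b..b} \<inter> J)"
    by (simp add: set_lebesgue_integral_def flip: indicator_inter_arith)
  also have "{-b..b} \<inter> J = {-b..<q} \<or> {-b..b} \<inter> J = {-b..q}" using J assms by auto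
  then have "measure lborel ({-b..b} \<inter> J) = q + b" using assms by auto
  finally show "(LBINT x:{-b..b}. indicator J x) = q + b" .
qed

text \<open>A quantile is thus, up to the shift \<open>b\<close>, a length, which lets
  \<open>I_fun\<close> of a step distortion be read as a combination of quantiles.\<close>

lemma integral_indicator_quantile:
  assumes "\<And>p q. p \<le> q \<Longrightarrow> L p \<Longrightarrow> L q" "L 1" "\<not> L 0"
    and "F \<in> compactly_supported" "measure F {-b..b} = 1"
  shows "set_integrable lborel {-b..b} (indicator {x. \<not> L (cdf F x)} :: real \<Rightarrow> real)"
    and "(LBINT x:{-b..b}. indicator {x. \<not> L (cdf F x)} x) = Inf {x. L (cdf F x)} + b"
proof -
  let ?q = "Inf {x. L (cdf F x)}"
  have "{..<?q} \<subseteq> {x. \<not> L (cdf F x)}"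
    using quantile_le_level[of L F] assms by force
  moreover have "{x. \<not> L (cdf F x)} \<subseteq> {..?q}"
    using level_above_quantile[of L F] assms by force
  moreover have "-b \<le> ?q" "?q \<le> b" using quantile_bounds[of L F b] assms by blast+
  ultimately show "set_integrable lborel {-b..b} (indicator {x. \<not> L (cdf F x)} :: real \<Rightarrow> real)"
    "(LBINT x:{-b..b}. indicator {x. \<not> L (cdf F x)} x) = ?q + b"
    by (rule integral_indicator_lower_set)+
qed

text \<open>The weight of \<open>G\<close> is positive, so the distribution function of the mixture
  is positive wherever that of \<open>G\<close> is.\<close>

lemma Q0_mixture_le:
  assumes "F \<in> compactly_supported" "G \<in> compactly_supported" "0 < l" "l < 1"
  shows "Q0 (mixture l F G) \<le> Q0 G"
proof -
  have rd: "real_distribution F" "real_distribution G"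
    using assms by (auto simp: compactly_supported_def)
  have l: "l \<in> {0..1}" using assms by auto
  show ?thesis
    unfolding Q0_def
  proof (rule quantile_le[OF _ _ _ mixture_compactly_supported[OF assms(1,2) l]])
    fix x assume "Inf {x. 0 < cdf G x} < x"
    then have "0 < cdf G x" using level_above_quantile[of "\<lambda>p. 0 < p" G x] assms by auto
    then show "0 < cdf (mixture l F G) x"
      using assms(3,4) measure_nonneg[of F "{..x}"]
      by (auto simp: cdf_def measure_mixture[OF rd l] intro: add_nonneg_pos)
  qed auto
qed

lemma Q1_mixture_le:
  assumes "F \<in> compactly_supported" "G \<in> compactly_supported" "0 < l" "l < 1" "Q1 F \<le> Q1 G"
  shows "Q1 (mixture l F G) \<le> Q1 G"
proof -
  have rd: "real_distribution F" "real_distribution G"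
    using assms by (auto simp: compactly_supported_def)
  have l: "l \<in> {0..1}" using assms by auto
  show ?thesis
    unfolding Q1_def
  proof (rule quantile_le[OF _ _ _ mixture_compactly_supported[OF assms(1,2) l]])
    fix x assume "Inf {x. 1 \<le> cdf G x} < x"
    moreover from this have "Inf {x. 1 \<le> cdf F x} < x" using assms(5) by (simp add: Q1_def)
    ultimately have "1 \<le> cdf F x" "1 \<le> cdf G x"
      using level_above_quantile[of "\<lambda>p. 1 \<le> p" _ x] assms by auto
    then have "l * 1 \<le> l * cdf F x" "(1 - l) * 1 \<le> (1 - l) * cdf G x"
      using assms by (auto intro!: mult_left_mono)
    then show "1 \<le> cdf (mixture l F G) x"
      by (auto simp: cdf_def measure_mixture[OF rd l])
  qed auto
qed

text \<open>The ordering of the lower quantiles controls the upper quantile as well: beyond the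
  upper quantile of \<open>G\<close>, the distribution function of \<open>G\<close> exceeds
  \<open>\<alpha>\<close> and that of \<open>F\<close> is at least \<open>\<alpha>\<close>, so the
  positive weight of \<open>G\<close> makes the mixture exceed \<open>\<alpha>\<close>.\<close>

lemma quantile_mixture_le:
  assumes "F \<in> compactly_supported" "G \<in> compactly_supported" "0 < l" "l < 1" "0 < \<alpha>" "\<alpha> < 1"
    and le: "Inf {x. \<alpha> \<le> cdf F x} \<le> Inf {x. \<alpha> \<le> cdf G x}"
  shows "Inf {x. \<alpha> \<le> cdf (mixture l F G) x} \<le> Inf {x. \<alpha> \<le> cdf G x}"
    and "Inf {x. \<alpha> < cdf (mixture l F G) x} \<le> Inf {x. \<alpha> < cdf G x}"
proof -
  have rd: "real_distribution F" "real_distribution G"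
    using assms by (auto simp: compactly_supported_def)
  have l: "l \<in> {0..1}" using assms by auto
  have cdf: "cdf (mixture l F G) x = l * cdf F x + (1 - l) * cdf G x" for x
    by (simp add: cdf_def measure_mixture[OF rd l])
  have alpha: "\<alpha> = l * \<alpha> + (1 - l) * \<alpha>" by (simp add: algebra_simps)
  have above: "\<alpha> \<le> cdf H x" if "H \<in> compactly_supported" "Inf {x. \<alpha> \<le> cdf H x} < x" for H x
    using level_above_quantile[of "\<lambda>p. \<alpha> \<le> p" H x] that assms by auto
  have above': "\<alpha> < cdf H x" if "H \<in> compactly_supported" "Inf {x. \<alpha> < cdf H x} < x" for H x
    using level_above_quantile[of "\<lambda>p. \<alpha> < p" H x] that assms by auto
  show "Inf {x. \<alpha> \<le> cdf (mixture l F G) x} \<le> Inf {x. \<alpha> \<le> cdf G x}"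
  proof (rule quantile_le[OF _ _ _ mixture_compactly_supported[OF assms(1,2) l]])
    fix x assume "Inf {x. \<alpha> \<le> cdf G x} < x"
    then have "\<alpha> \<le> cdf F x" "\<alpha> \<le> cdf G x"
      using above[OF assms(1), of x] above[OF assms(2), of x] le by linarith+
    then have "l * \<alpha> \<le> l * cdf F x" "(1 - l) * \<alpha> \<le> (1 - l) * cdf G x"
      using l by (auto intro!: mult_left_mono)
    then show "\<alpha> \<le> cdf (mixture l F G) x" using alpha by (simp add: cdf)
  qed (use assms in auto)
  have le': "Inf {x. \<alpha> \<le> cdf G x} \<le> Inf {x. \<alpha> < cdf G x}"
    by (rule quantile_le[OF _ _ _ assms(2)]) (use above'[OF assms(2)] assms(5,6) in force)+
  show "Inf {x. \<alpha> < cdf (mixture l F G) x} \<le> Inf {x. \<alpha> < cdf G x}"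
  proof (rule quantile_le[OF _ _ _ mixture_compactly_supported[OF assms(1,2) l]])
    fix x assume "Inf {x. \<alpha> < cdf G x} < x"
    then have "\<alpha> \<le> cdf F x" "\<alpha> < cdf G x"
      using above[OF assms(1), of x] above'[OF assms(2), of x] le le' by linarith+
    then have "l * \<alpha> \<le> l * cdf F x" "(1 - l) * \<alpha> < (1 - l) * cdf G x"
      using assms(3,4) by (auto intro!: mult_left_mono mult_strict_left_mono)
    then show "\<alpha> < cdf (mixture l F G) x" using alpha by (simp add: cdf)
  qed (use assms in auto)
qed

lemma Q_mixture_le:
  assumes "F \<in> compactly_supported" "G \<in> compactly_supported" "0 < l" "l < 1" "\<alpha> \<in> {0..1}"
    and "Q_minus \<alpha> F \<le> Q_minus \<alpha> G"
  shows "Q_minus \<alpha> (mixture l F G) \<le> Q_minus \<alpha> G" "Q_plus \<alpha> (mixture l F G) \<le> Q_plus \<alpha> G"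
proof -
  consider "\<alpha> = 0" | "\<alpha> = 1" | "0 < \<alpha>" "\<alpha> < 1" using assms(5) by force
  then have "Q_minus \<alpha> (mixture l F G) \<le> Q_minus \<alpha> G \<and> Q_plus \<alpha> (mixture l F G) \<le> Q_plus \<alpha> G"
  proof cases
    case 1
    then show ?thesis
      using Q0_mixture_le[OF assms(1-4)] by (simp add: Q_minus_def Q_plus_def)
  next
    case 2
    then show ?thesis
      using Q1_mixture_le[OF assms(1-4)] assms(6) by (simp add: Q_minus_def Q_plus_def)
  next
    case 3
    then show ?thesis
      using quantile_mixture_le[OF assms(1-4) 3] assms(6) by (simp add: Q_minus_def Q_plus_def)
  qed
  then show "Q_minus \<alpha> (mixture l F G) \<le> Q_minus \<alpha> G" "Q_plus \<alpha> (mixture l F G) \<le> Q_plus \<alpha> G"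
    by auto
qed

lemma min_quantile_mixture_imp_p_quasi_convex:
  assumes "min_quantile_mixture \<rho>"
  shows "p_quasi_convex_on compactly_supported \<rho>"
proof -
  obtain \<alpha> c k where par: "\<alpha> \<in> {0..1}" "c \<in> {0..1}" "k \<in> {0..1}"
    and \<rho>: "\<And>F. F \<in> compactly_supported \<Longrightarrow> \<rho> F = k * Q_mix c \<alpha> F + (1 - k) * Q0 F"
    using assms unfolding min_quantile_mixture_def by blast
  \<comment> \<open>One component dominates all three quantiles simultaneously; bounds by different
    components would not combine to a maximum of \<open>\<rho>\<close>.\<close>
  have le: "\<rho> (mixture l F G) \<le> \<rho> G"
    if FG: "F \<in> compactly_supported" "G \<in> compactly_supported" "0 < l" "l < 1"
      and Q: "Q_minus \<alpha> F \<le> Q_minus \<alpha> G" for l F G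
  proof -
    have "Q_mix c \<alpha> (mixture l F G) \<le> Q_mix c \<alpha> G"
      unfolding Q_mix_def
      by (intro add_mono mult_left_mono Q_mixture_le[OF FG par(1) Q]) (use par in auto)
    then have "k * Q_mix c \<alpha> (mixture l F G) + (1 - k) * Q0 (mixture l F G)
        \<le> k * Q_mix c \<alpha> G + (1 - k) * Q0 G"
      by (intro add_mono mult_left_mono Q0_mixture_le[OF FG]) (use par in auto)
    then show ?thesis using \<rho> FG mixture_compactly_supported by simp
  qed
  show ?thesis
    unfolding p_quasi_convex_on_def
  proof (intro ballI)
    fix F G and l :: real
    assume FG: "F \<in> compactly_supported" "G \<in> compactly_supported" and "l \<in> {0..1}"
    then consider "l = 0" | "l = 1" | "0 < l" "l < 1" by force
    then show "\<rho> (mixture l F G) \<le> max (\<rho> F) (\<rho> G)"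
    proof cases
      case 3
      show ?thesis
      proof (cases "Q_minus \<alpha> F \<le> Q_minus \<alpha> G")
        case True
        then show ?thesis using le[OF FG 3] by simp
      next
        case False
        then show ?thesis using le[OF FG(2,1), of "1 - l"] 3 mixture_commute[of l F G] by simp
      qed
    qed (use FG mixture_endpoints in \<open>auto simp: compactly_supported_def\<close>)
  qed
qed

text \<open>With \<open>p\<close> the value of the distribution function, \<open>h (1 - p)\<close>
  is a combination of three steps in \<open>p\<close>, two at the level \<open>1 - \<beta>\<close>
  and one at 0; each integrates to a quantile.\<close>

lemma step_imp_min_quantile_mixture:
  assumes h: "h \<in> H_DT" and beta: "0 \<le> \<beta>" "\<beta> < 1"
    and below: "\<And>x. 0 \<le> x \<Longrightarrow> x < \<beta> \<Longrightarrow> h x = 0"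
    and above: "\<And>x y. \<beta> < x \<Longrightarrow> x < 1 \<Longrightarrow> \<beta> < y \<Longrightarrow> y < 1 \<Longrightarrow> h x = h y"
  shows "min_quantile_mixture (I_fun h)"
proof -
  define k where "k = h ((\<beta> + 1) / 2)"
  have mono: "mono_on {0..1} h" and h01: "h 0 = 0" "h 1 = 1" using h by (auto simp: H_DT_def)
  have above_k: "h x = k" if "\<beta> < x" "x < 1" for x
    unfolding k_def by (rule above) (use that beta in auto)
  have k01: "k \<in> {0..1}"
    using mono_onD[OF mono, of 0 "(\<beta> + 1) / 2"] mono_onD[OF mono, of "(\<beta> + 1) / 2" 1] beta h01
    by (auto simp: k_def)
  have hb: "0 \<le> h \<beta>" "h \<beta> \<le> k"
    using mono_onD[OF mono, of 0 \<beta>] mono_onD[OF mono, of \<beta> "(\<beta> + 1) / 2"] beta h01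
    by (auto simp: k_def)
  \<comment> \<open>For \<open>k = 0\<close> the division gives 0, and
    \<open>k * c = h \<beta>\<close> still holds because \<open>h \<beta>\<close> lies between 0 and
    \<open>k\<close>.\<close>
  define c where "c = h \<beta> / k"
  have ck: "k * c = h \<beta>" using hb by (auto simp: c_def)
  have c01: "c \<in> {0..1}" using hb k01 by (cases "k = 0") (auto simp: c_def)
  \<comment> \<open>\<open>\<beta> = 0\<close> means level 1, where \<open>Q_plus\<close> is by
    definition \<open>Q1\<close>; hence the non-strict condition in \<open>Lp\<close>.\<close>
  define Lm Lp Lz where "Lm p \<longleftrightarrow> 1 - \<beta> \<le> p" and "Lp p \<longleftrightarrow> (if \<beta> = 0 then 1 \<le> p else 1 - \<beta> < p)"
    and "Lz p \<longleftrightarrow> 0 < p"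
    for p :: real
  have L: "\<And>p q. p \<le> q \<Longrightarrow> Lm p \<Longrightarrow> Lm q" "Lm 1" "\<not> Lm 0"
    "\<And>p q. p \<le> q \<Longrightarrow> Lp p \<Longrightarrow> Lp q" "Lp 1" "\<not> Lp 0"
    "\<And>p q. p \<le> q \<Longrightarrow> Lz p \<Longrightarrow> Lz q" "Lz 1" "\<not> Lz 0"
    using beta by (auto simp: Lm_def Lp_def Lz_def split: if_splits)
  have Q: "Q_minus (1 - \<beta>) F = Inf {x. Lm (cdf F x)}" "Q_plus (1 - \<beta>) F = Inf {x. Lp (cdf F x)}"
    "Q0 F = Inf {x. Lz (cdf F x)}" for F
    using beta by (simp_all add: Lz_def Q0_def Q_minus_def Q_plus_def Q1_def Lm_def Lp_def)
  have hp: "h (1 - p) = k * c * of_bool (\<not> Lp p) + k * (1 - c) * of_bool (\<not> Lm p)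
      + (1 - k) * of_bool (\<not> Lz p)" if p: "p \<in> {0..1}" for p
  proof -
    have kc: "k * (1 - c) = k - h \<beta>" using ck by (simp add: algebra_simps)
    consider "p = 0" | "0 < p" "p < 1 - \<beta>" | "0 < p" "p = 1 - \<beta>" | "1 - \<beta> < p" using p beta by force
    then show ?thesis
    proof cases
      case 1
      then show ?thesis using beta L by (simp add: kc ck h01 of_bool_def)
    next
      case 2
      then have "h (1 - p) = k" using beta by (intro above_k) auto
      moreover have "\<not> Lp p" "\<not> Lm p" using 2 beta by (auto simp: Lm_def Lp_def)
      ultimately show ?thesis using 2 by (simp add: Lz_def kc ck)
    next
      case 3
      then show ?thesis using h01 by (simp add: kc ck Lm_def Lp_def Lz_def)
    next
      case 4
      then have "h (1 - p) = 0" using p by (intro below) auto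
      moreover have "Lp p" "Lm p" "Lz p" using 4 p beta by (auto simp: Lm_def Lp_def Lz_def)
      ultimately show ?thesis by simp
    qed
  qed
  have "I_fun h F = k * Q_mix c (1 - \<beta>) F + (1 - k) * Q0 F" if F: "F \<in> compactly_supported" for F
  proof -
    obtain b where b: "0 \<le> b" "measure F {-b..b} = 1" using compactly_supportedE[OF F] by blast
    have rd: "real_distribution F" using F by (simp add: compactly_supported_def)
    interpret real_distribution F by fact
    note m = integral_indicator_quantile[of Lm F b, OF L(1-3) F b(2)]
    note p = integral_indicator_quantile[of Lp F b, OF L(4-6) F b(2)]
    note z = integral_indicator_quantile[of Lz F b, OF L(7-9) F b(2)]
    have "h (measure F {x<..}) = k * c * indicator {x. \<not> Lp (cdf F x)} x
        + k * (1 - c) * indicator {x. \<not> Lm (cdf F x)} x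
        + (1 - k) * indicator {x. \<not> Lz (cdf F x)} x" for x
      using hp[of "cdf F x"] cdf_nonneg[of x] cdf_bounded_prob[of x]
      by (simp add: survival_eq_cdf[OF rd] indicator_def of_bool_def)
    then have "(LBINT x:{-b..b}. h (measure F {x<..}))
        = (LBINT x:{-b..b}. k * c * indicator {x. \<not> Lp (cdf F x)} x
        + k * (1 - c) * indicator {x. \<not> Lm (cdf F x)} x
        + (1 - k) * indicator {x. \<not> Lz (cdf F x)} x)"
      by simp
    also have "\<dots> = k * c * (Q_plus (1 - \<beta>) F + b) + k * (1 - c) * (Q_minus (1 - \<beta>) F + b)
        + (1 - k) * (Q0 F + b)"
      by (simp add: Q set_integral_add m p z)
    finally show ?thesis
      by (simp add: I_fun_eq[OF h rd b] Q_mix_def algebra_simps)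
  qed
  then show ?thesis
    unfolding min_quantile_mixture_def using beta c01 k01
    by (intro bexI[of _ "1 - \<beta>"] bexI[of _ c] bexI[of _ k]) auto
qed

text \<open>The survival function takes the values 1, \<open>s\<close>, \<open>t\<close>, 0 and
  drops at \<open>a\<close>, \<open>b\<close>, \<open>c\<close>; its distortion is a sum of
  indicators of half-lines, weighted by the drops after distortion.\<close>

lemma I_fun_three_points:
  assumes h: "h \<in> H_DT" and F: "real_distribution F" and abc: "a \<le> b" "b \<le> c"
    and st: "0 \<le> t" "t \<le> s" "s \<le> 1"
    and surv: "\<And>A. A \<in> sets borel \<Longrightarrow>
      measure F A = (1 - s) * indicator A a + (s - t) * indicator A b + t * indicator A c"
  shows "I_fun h F = a + (b - a) * h s + (c - b) * h t"
proof -
  define B where "B = \<bar>a\<bar> + \<bar>b\<bar> + \<bar>c\<bar>"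
  have B: "0 \<le> B" "-B \<le> a" "a \<le> B" "-B \<le> b" "b \<le> B" "-B \<le> c" "c \<le> B" by (auto simp: B_def)
  have supp: "measure F {-B..B} = 1" using surv[of "{-B..B}"] B by simp
  have h01: "h 0 = 0" "h 1 = 1" using h by (auto simp: H_DT_def)
  note int = integral_indicator_lower_set[of q "{..<q}" B for q, OF order_refl]
  have sub: "{..<q} \<subseteq> {..q}" for q :: real by auto
  have "h (measure F {x<..}) = (1 - h s) * indicator {..<a} x + (h s - h t) * indicator {..<b} x
      + h t * indicator {..<c} x" for x
    using abc by (auto simp: surv h01 indicator_def)
  then have "(LBINT x:{-B..B}. h (measure F {x<..})) =
      (LBINT x:{-B..B}. (1 - h s) * indicator {..<a} x + (h s - h t) * indicator {..<b} x
      + h t * indicator {..<c} x)"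
    by simp
  also have "\<dots> = (1 - h s) * (a + B) + (h s - h t) * (b + B) + h t * (c + B)"
    using B sub by (simp add: set_integral_add int)
  finally show ?thesis by (simp add: I_fun_eq[OF h F B(1) supp] algebra_simps)
qed

section \<open>Necessity\<close>

lemma ordered_triple:
  fixes f :: "'a \<Rightarrow> real"
  assumes "P x" "P y" "P z" "f x \<noteq> f y" "f x \<noteq> f z" "f y \<noteq> f z"
  obtains a b c where "P a" "P b" "P c" "f a < f b" "f b < f c"
  using assms by (metis linorder_neqE_linordered_idom)

text \<open>The distributions \<open>D s t\<close> on three points lie in \<open>M\<close> by
  convexity, and mixing them acts affinely on \<open>(s,t)\<close>; this transfers quasi-convexity
  from \<open>R_fun\<close> to the separable sum.\<close>

lemma p_quasi_convex_imp_convex_or_min_quantile_mixture: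
  assumes h: "h \<in> H_DT" and M: "M \<subseteq> compactly_supported" "convex_distributions M"
    and v: "v \<in> V_set M" and pqc: "p_quasi_convex_on M (R_fun h v)"
  shows "convex_on {0..1} h \<or> min_quantile_mixture (I_fun h)"
proof -
  have vm: "v \<in> borel_measurable borel" using v by (simp add: V_set_def)
  \<comment> \<open>The points are labelled in the order of their images under \<open>v\<close>, so
    that \<open>u\<close> and \<open>w\<close> are positive.\<close>
  obtain x y z where xyz: "return borel x \<in> M" "return borel y \<in> M" "return borel z \<in> M"
    and less: "v x < v y" "v y < v z"
    using v ordered_triple[of "\<lambda>x. return borel x \<in> M" _ _ _ v] unfolding V_set_def by blast
  have rdM: "real_distribution F" if "F \<in> M" for F
    using that M by (auto simp: compactly_supported_def)
  have mixM: "mixture l F G \<in> M" if "F \<in> M" "G \<in> M" "l \<in> {0..1}" for l F G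
    using that M(2) by (simp add: convex_distributions_def)
  define u w where "u = v y - v x" and "w = v z - v y"
  \<comment> \<open>For \<open>s = 0\<close> the quotient is 0 by convention, and the inner mixture
    then has weight 0 anyway.\<close>
  define D where "D s t = mixture (1 - s) (return borel x)
      (mixture ((s - t) / s) (return borel y) (return borel z))" for s t
  have D: "D s t \<in> M" "A \<in> sets borel \<Longrightarrow> measure (D s t) A =
      (1 - s) * indicator A x + (s - t) * indicator A y + t * indicator A z"
    if st: "0 \<le> t" "t \<le> s" "s \<le> 1" for s t A
  proof -
    have l: "(s - t) / s \<in> {0..1}" "1 - s \<in> {0..1}" using st by (auto simp: divide_simps)
    have yz: "mixture ((s - t) / s) (return borel y) (return borel z) \<in> M"
      using xyz l by (intro mixM) auto
    then show "D s t \<in> M" unfolding D_def using xyz l by (intro mixM) auto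
    assume A: "A \<in> sets borel"
    have s: "s * ((s - t) / s) = s - t" "s * (1 - (s - t) / s) = t"
      using st by (cases "s = 0"; simp add: field_simps)+
    have "measure (D s t) A = (1 - s) * indicator A x
        + s * ((s - t) / s * indicator A y + (1 - (s - t) / s) * indicator A z)"
      unfolding D_def using A l xyz yz by (simp add: measure_mixture rdM measure_return)
    also have "\<dots> = (1 - s) * indicator A x + (s * ((s - t) / s)) * indicator A y
        + (s * (1 - (s - t) / s)) * indicator A z"
      by (simp only: distrib_left mult.assoc add.assoc)
    finally show "measure (D s t) A =
      (1 - s) * indicator A x + (s - t) * indicator A y + t * indicator A z"
      unfolding s .
  qed
  \<comment> \<open>Stated for every \<open>F\<close> with these values, because it is applied to
    mixtures of the \<open>D s t\<close> too.\<close>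
  have R: "R_fun h v F = v x + u * h s + w * h t"
    if st: "0 \<le> t" "t \<le> s" "s \<le> 1" and F: "F \<in> M"
      and FA: "\<And>A. A \<in> sets borel \<Longrightarrow> measure F A =
        (1 - s) * indicator A x + (s - t) * indicator A y + t * indicator A z" for F s t
  proof -
    interpret real_distribution F by (rule rdM[OF F])
    have "measure (distr F borel v) A =
        (1 - s) * indicator A (v x) + (s - t) * indicator A (v y) + t * indicator A (v z)"
      if A: "A \<in> sets borel" for A
      using measurable_sets[OF vm A] FA[of "v -` A"] A vm by (simp add: measure_distr indicator_def)
    then show ?thesis
      unfolding R_fun_def u_def w_def using less st vm by (intro I_fun_three_points[OF h]) auto
  qed
  interpret separable_quasiconvex h u w
  proof
    show "mono_on {0..1} h" using h by (simp add: H_DT_def)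
    show "0 < u" "0 < w" using less by (auto simp: u_def w_def)
    fix t s t' s' l :: real
    assume st: "0 \<le> t" "t \<le> s" "s \<le> 1" and st': "0 \<le> t'" "t' \<le> s'" "s' \<le> 1" and l: "0 \<le> l" "l \<le> 1"
    let ?s = "l * s + (1 - l) * s'" and ?t = "l * t + (1 - l) * t'"
    let ?F = "mixture l (D s t) (D s' t')"
    have F: "?F \<in> M" using D(1)[OF st] D(1)[OF st'] l by (intro mixM) auto
    have "?s \<le> l * 1 + (1 - l) * 1" using st st' l by (intro add_mono mult_left_mono) auto
    moreover have "?t \<le> ?s" using st st' l by (intro add_mono mult_left_mono) auto
    moreover have "0 \<le> ?t" using st st' l by simp
    moreover have "measure ?F A =
        (1 - ?s) * indicator A x + (?s - ?t) * indicator A y + ?t * indicator A z"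
      if A: "A \<in> sets borel" for A
    proof -
      have "measure ?F A = l * measure (D s t) A + (1 - l) * measure (D s' t') A"
        using A l D(1)[OF st] D(1)[OF st'] by (simp add: measure_mixture rdM)
      then show ?thesis
        unfolding D(2)[OF st A] D(2)[OF st' A] by (simp add: algebra_simps)
    qed
    ultimately have "R_fun h v ?F = v x + u * h ?s + w * h ?t"
      using F by (intro R) auto
    moreover have "R_fun h v ?F \<le> max (R_fun h v (D s t)) (R_fun h v (D s' t'))"
      using pqc D(1)[OF st] D(1)[OF st'] l by (simp add: p_quasi_convex_on_def)
    ultimately show "u * h ?s + w * h ?t \<le> max (u * h s + w * h t) (u * h s' + w * h t')"
      using R[OF st D[OF st]] R[OF st' D[OF st']] by (simp add: max_def split: if_splits)
  qed
  have "h 0 = 0" using h by (simp add: H_DT_def)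
  then show ?thesis
    using convex_or_step step_imp_min_quantile_mixture[OF h] by metis
qed

theorem theorem1:
  fixes M :: "real measure set" and h :: "real \<Rightarrow> real"
  assumes "M \<subseteq> compactly_supported"
    and "convex_distributions M"
    and "\<exists>x y z. x \<noteq> y \<and> x \<noteq> z \<and> y \<noteq> z \<and>
           return borel x \<in> M \<and> return borel y \<in> M \<and> return borel z \<in> M"
    and "h \<in> H_DT"
  shows "((convex_on {0..1} h \<or> min_quantile_mixture (I_fun h))
            \<longleftrightarrow> p_quasi_convex_on M (I_fun h)) \<and>
         (p_quasi_convex_on M (I_fun h)
            \<longleftrightarrow> (\<exists>v\<in>V_set M. mono v \<and> p_quasi_convex_on M (R_fun h v))) \<and>
         ((\<exists>v\<in>V_set M. mono v \<and> p_quasi_convex_on M (R_fun h v))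
            \<longleftrightarrow> (\<forall>v. mono v \<longrightarrow> p_quasi_convex_on M (R_fun h v)))"
    (is "(?i \<longleftrightarrow> ?ii) \<and> (?ii \<longleftrightarrow> ?iii) \<and> (?iii \<longleftrightarrow> ?iv)")
proof -
  \<comment> \<open>The identity lies in \<open>V_set M\<close> thanks to the three distinct points;
    it leads from (iv) to (ii) and from (ii) to (iii) in the cycle (i), (iv), (ii), (iii),
    (i).\<close>
  have id: "mono (\<lambda>x::real. x)" "(\<lambda>x. x) \<in> V_set M"
    using assms(3) by (auto simp: mono_def V_set_def)
  have "R_fun h (\<lambda>x. x) F = I_fun h F" if "F \<in> M" for F
    using that assms(1) by (intro R_fun_id) (auto simp: compactly_supported_def)
  then have R_id: "p_quasi_convex_on M (R_fun h (\<lambda>x. x)) \<longleftrightarrow> ?ii"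
    using assms(2) by (simp add: p_quasi_convex_on_def convex_distributions_def)
  have "p_quasi_convex_on compactly_supported (I_fun h)" if ?i
    using that convex_imp_p_quasi_convex[OF assms(4)] min_quantile_mixture_imp_p_quasi_convex
    by blast
  then have "?i \<Longrightarrow> ?iv"
    using p_quasi_convex_on_R_fun assms(1) by blast
  moreover have "?iv \<Longrightarrow> ?ii" "?ii \<Longrightarrow> ?iii"
    using R_id id by blast+
  moreover have "?iii \<Longrightarrow> ?i"
    using p_quasi_convex_imp_convex_or_min_quantile_mixture[OF assms(4,1,2)] by blast
  ultimately show ?thesis by blast
qed

end
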